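(* There exists an absolute constant $\delta>0$ such that for all primes $M$, at least $\delta M$ of the test functions $\{\phi_j^{(M)}\}_{j=1}^{\nu(M)}$ (constructed from $\phi_0$ as in the context) satisfy the QUE conjecture on shrinking sets. That is, for these $\phi=\phi_j^{(M)}$ we have $$|c_1|\cdot|\langle G,\phi\rangle_M|+|c_M|\cdot|\langle G|_M,\phi\rangle_M|\ll M^{-1}\|\phi_0\|_1,$$ while the term $c_0\langle 1,\phi\rangle_M$ is expected to be approximately $\frac{6\log N}{\pi M}\langle 1,\phi_0\rangle_1$. Here $c_0,c_1,c_M$ are the coefficients described in the context.
   Context: $Y_0(M)=\Gamma_0(M)\backslash\mathbb H$, $d\mu=y^{-2}dx\,dy$, $\langle f,g\rangle_M=\int_{Y_0(M)}f\overline g\,d\mu$, $\|\phi_0\|_1=\langle|\phi_0|,1\rangle_1$. Dependence of implied constants on ambient parameters (other than $\varepsilon$) is typically indicated by subscripts. Test functions: $\phi_0$ is a once and for all fixed smooth $SL_2(\mathbb Z)$-invariant function with compact and connected support, whose support, restricted to the standard fundamental domain $\mathcal D$ of $SL_2(\mathbb Z)$, is contained in the interior of $\mathcal D$. Let $\nu(M)=[SL_2(\mathbb Z):\Gamma_0(M)]$ and $SL_2(\mathbb Z)=\bigsqcup_{j=1}^{\nu(M)}\Gamma_0(M)\gamma_j$. Then $\phi_j^{(M)}$ is the $\Gamma_0(M)$-invariant function with $\phi_j^{(M)}(\tau\gamma_kz)=\phi_0(z)$ if $k=j$ and $0$ if $k\ne j$, for $\tau\in\Gamma_0(M)$, $z\in\mathcal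 D$. $G$ is the $SL_2(\mathbb Z)$-invariant function defined by $E(z,s)=\frac{3/\pi}{s-1}+G(z)+O(|s-1|)$ near $s=1$, where $E(z,s)=\frac12\sum_{\gcd(c,d)=1}y^s|cz+d|^{-2s}$ is the level $1$ Eisenstein series (continued meromorphically); $G|_M(z)=G(Mz)$. Setting for the coefficients: $T\ne0$ is a fixed real number, $\chi$ is a primitive even Dirichlet character mod $N$, and $M\mid N$ is prime (the surrounding discussion concerns $M\gg(\log N)^{1+\delta'}$ for some $\delta'>0$). For a cusp $\mathfrak a$ singular for $\chi$ (i.e. $\chi$, evaluated at lower-right entries, is trivial on the stabilizer $\Gamma_{\mathfrak a}$ of $\mathfrak a$ in $\Gamma_0(N)$), let $\sigma_{\mathfrak a}\in SL_2(\mathbb R)$ satisfy $\sigma_{\mathfrak a}\infty=\mathfrak a$, $\sigma_{\mathfrak a}^{-1}\Gamma_{\mathfrak a}\sigma_{\mathfrak a}=\{\pm\begin{pmatrix}1&n\\0&1\end{pmatrix}:n\in\mathbb Z\}$, and let $E_{\mathfrak a}(z,s,\chi)=\sum_{\gamma\in\Gamma_{\mathfrak a}\backslash\Gamma_0(N)}\overline\chi(\gamma)(\Im\sigma_{\mathfrak a}^{-1}\gamma z)^s$, continued meromorphically; $E_{\mathfrak a}(z,s)$ is the case of the trivial character mod $N$. Let $\varphi_{\infty 0}(s,\chi)$ be the coefficient of $y^{1-s}$ in the constant term of $E_\infty(\sigma_0z,s,\chi)$. The function $$\mathcal E=\lim_{\beta\to0^+}\Big(E_\infty(z,1+\beta)+\varphi_{\infty0}(\tfrac12+iT,\chi)\varphi_{\infty0}(\tfrac12+\beta-iT,\overline\chi)E_0(z,1-\beta)\Big)$$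 regularizes $|E_\infty(\cdot,\frac12+iT,\chi)|^2$ (their difference is in $L^2(Y_0(N))$), and for $\phi=\phi_j^{(M)}$, $$\langle\mathcal E,\phi\rangle_N=c_0\langle1,\phi\rangle_M+c_1\langle G,\phi\rangle_M+c_M\langle G|_M,\phi\rangle_M,$$ with $c_0=\frac1{\langle1,1\rangle_M}\big(\log\frac{N^2}M+4\Re\frac{L'}L(1+2iT,\overline\chi)+O_{T,\phi_0}(1)\big)$ and $c_1=c_M=\frac{\zeta(2)}{L(2,\chi_{0,M})}(M^{-1}-M^{-2})=M^{-1}+O(M^{-2})$, where $\chi_{0,M}$ is the principal character mod $M$. *)

theory Defs
  imports "HOL-Complex_Analysis.Complex_Analysis" "HOL-Library.Landau_Symbols"
begin

definition uhp :: "complex set" where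
  "uhp = {z. Im z > 0}"

definition SL2Z :: "(int^2^2) set" where
  "SL2Z = {A. det A = 1}"

definition Gamma0 :: "nat \<Rightarrow> (int^2^2) set" where
  "Gamma0 M = {A \<in> SL2Z. int M dvd A $ 2 $ 1}"

definition moebius :: "int^2^2 \<Rightarrow> complex \<Rightarrow> complex" where
  "moebius A z = (of_int (A $ 1 $ 1) * z + of_int (A $ 1 $ 2)) /
                 (of_int (A $ 2 $ 1) * z + of_int (A $ 2 $ 2))"

definition Gamma0_coset :: "nat \<Rightarrow> int^2^2 \<Rightarrow> (int^2^2) set" where
  "Gamma0_coset M g = (\<lambda>t. t ** g) ` Gamma0 M"

definition Gamma0_cosets :: "nat \<Rightarrow> (int^2^2) set set" where
  "Gamma0_cosets M = Gamma0_coset M ` SL2Z"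

definition index_nu :: "nat \<Rightarrow> nat" where
  "index_nu M = card (Gamma0_cosets M)"

definition coset_reps :: "nat \<Rightarrow> (nat \<Rightarrow> int^2^2) \<Rightarrow> bool" where
  "coset_reps M g \<longleftrightarrow>
     (\<forall>j\<in>{1..index_nu M}. g j \<in> SL2Z) \<and>
     disjoint_family_on (\<lambda>j. Gamma0_coset M (g j)) {1..index_nu M} \<and>
     (\<Union>j\<in>{1..index_nu M}. Gamma0_coset M (g j)) = SL2Z"

definition std_domain :: "complex set" where
  "std_domain = {z \<in> uhp. \<bar>Re z\<bar> \<le> 1/2 \<and> norm z \<ge> 1}"

definition hyp_measure :: "complex measure" where
  "hyp_measure = density lborel (\<lambda>z. ennreal (indicator uhp z / (Im z)\<^sup>2))"

text \<open>
  The union of the translates of the standard domain by one representative of each coset in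
  \<open>\<Gamma>\<^sub>0(M)\<setminus>SL\<^sub>2(\<int>)\<close> is a fundamental domain of \<open>\<Gamma>\<^sub>0(M)\<close> (translates overlap in null sets only).
  The integral of a \<open>\<Gamma>\<^sub>0(M)\<close>-invariant function over it is the integral over \<open>Y\<^sub>0(M)\<close>; it does
  not depend on which representatives are selected.
\<close>

definition Y0_domain :: "nat \<Rightarrow> complex set" where
  "Y0_domain M = (\<Union>c\<in>Gamma0_cosets M. moebius (SOME g. g \<in> c) ` std_domain)"

definition Y0_inner :: "nat \<Rightarrow> (complex \<Rightarrow> complex) \<Rightarrow> (complex \<Rightarrow> complex) \<Rightarrow> complex" where
  "Y0_inner M f h = set_lebesgue_integral hyp_measure (Y0_domain M) (\<lambda>z. f z * cnj (h z))"

definition L1_norm :: "(complex \<Rightarrow> complex) \<Rightarrow> real" where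
  "L1_norm f = Re (Y0_inner 1 (\<lambda>z. of_real (norm (f z))) (\<lambda>_. 1))"

text \<open>
  Real differentiability of all orders on an open set; \<^const>\<open>frechet_derivative\<close> is the real
  Frechet derivative, so this is \<open>C\<^sup>\<infinity>\<close> in the two real variables and not holomorphy.
\<close>

primrec Ck_on :: "nat \<Rightarrow> complex set \<Rightarrow> (complex \<Rightarrow> complex) \<Rightarrow> bool" where
  "Ck_on 0 S f \<longleftrightarrow> continuous_on S f"
| "Ck_on (Suc n) S f \<longleftrightarrow> (\<forall>z\<in>S. f differentiable (at z)) \<and>
     (\<forall>v. Ck_on n S (\<lambda>z. frechet_derivative f (at z) v))"

definition smooth_on :: "complex set \<Rightarrow> (complex \<Rightarrow> complex) \<Rightarrow> bool" where
  "smooth_on S f \<longleftrightarrow> (\<forall>n. Ck_on n S f)"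

text \<open>
  The support of an \<open>SL\<^sub>2(\<int>)\<close>-invariant function is invariant, hence never compact in the upper
  half-plane unless empty.  Compactness and connectedness refer to its image in
  \<open>SL\<^sub>2(\<int>)\<setminus>\<H>\<close>, that is, to its part in the standard domain.
\<close>

definition base_function :: "(complex \<Rightarrow> complex) \<Rightarrow> bool" where
  "base_function f \<longleftrightarrow>
     smooth_on uhp f \<and>
     (\<forall>g\<in>SL2Z. \<forall>z\<in>uhp. f (moebius g z) = f z) \<and>
     (let K = closure {z \<in> uhp. f z \<noteq> 0} \<inter> std_domain
      in compact K \<and> connected K \<and> K \<subseteq> interior std_domain)"

definition test_functions ::
  "(complex \<Rightarrow> complex) \<Rightarrow> nat \<Rightarrow> (nat \<Rightarrow> int^2^2) \<Rightarrow> (nat \<Rightarrow> complex \<Rightarrow> complex) \<Rightarrow> bool" where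
  "test_functions f M g \<phi> \<longleftrightarrow>
     (\<forall>j\<in>{1..index_nu M}.
        (\<forall>t\<in>Gamma0 M. \<forall>z\<in>uhp. \<phi> j (moebius t z) = \<phi> j z) \<and>
        (\<forall>k\<in>{1..index_nu M}. \<forall>t\<in>Gamma0 M. \<forall>z\<in>std_domain.
           \<phi> j (moebius (t ** g k) z) = (if k = j then f z else 0)))"

definition eisenstein :: "complex \<Rightarrow> complex \<Rightarrow> complex" where
  "eisenstein z s = 1/2 * (\<Sum>\<^sub>\<infinity>(c, d)\<in>{(c :: int, d :: int). coprime c d}.
     of_real (Im z) powr s * of_real (norm (of_int c * z + of_int d)) powr (-2 * s))"

text \<open>
  A meromorphic continuation of \<open>s \<mapsto> E(z,s)\<close> to a domain containing \<open>1\<close>.  By the identity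
  theorem its germ at \<open>1\<close> is that of the continuation to the whole plane.
\<close>

definition eisenstein_continuation :: "complex \<Rightarrow> complex set \<Rightarrow> (complex \<Rightarrow> complex) \<Rightarrow> bool" where
  "eisenstein_continuation z U E \<longleftrightarrow>
     open U \<and> connected U \<and> {s. Re s > 1} \<subseteq> U \<and> 1 \<in> U \<and>
     E meromorphic_on U \<and> (\<forall>s. Re s > 1 \<longrightarrow> E s = eisenstein z s)"

definition eisenstein_G :: "complex \<Rightarrow> complex" where
  "eisenstein_G z = (THE w. \<exists>U E. eisenstein_continuation z U E \<and>
     (\<lambda>s. E s - of_real (3 / pi) / (s - 1) - w) \<in> O[at 1](\<lambda>s. s - 1))"

definition eisenstein_G_level :: "nat \<Rightarrow> complex \<Rightarrow> complex" where
  "eisenstein_G_level M z = eisenstein_G (of_nat M * z)"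

definition dirichlet_character :: "nat \<Rightarrow> (int \<Rightarrow> complex) \<Rightarrow> bool" where
  "dirichlet_character N chi \<longleftrightarrow> N > 0 \<and>
     (\<forall>m n. chi (m * n) = chi m * chi n) \<and>
     (\<forall>n. chi (n + int N) = chi n) \<and>
     (\<forall>n. chi n \<noteq> 0 \<longleftrightarrow> coprime n (int N))"

definition primitive_character :: "nat \<Rightarrow> (int \<Rightarrow> complex) \<Rightarrow> bool" where
  "primitive_character N chi \<longleftrightarrow> dirichlet_character N chi \<and>
     (\<forall>d. d dvd N \<and> d < N \<longrightarrow>
        (\<exists>n. coprime n (int N) \<and> n mod int d = 1 mod int d \<and> chi n \<noteq> 1))"

definition even_character :: "(int \<Rightarrow> complex) \<Rightarrow> bool" where
  "even_character chi \<longleftrightarrow> chi (-1) = 1"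

definition principal_character :: "nat \<Rightarrow> int \<Rightarrow> complex" where
  "principal_character M n = (if coprime n (int M) then 1 else 0)"

text \<open>
  Conditionally convergent summation, so for a non-principal character this is \<open>L(s,chi)\<close> on the
  whole half-plane \<open>Re s > 0\<close>, in particular near the line \<open>Re s = 1\<close>.  The principal character
  mod \<open>1\<close> gives the zeta function for \<open>Re s > 1\<close>.
\<close>

definition dirichlet_L :: "(int \<Rightarrow> complex) \<Rightarrow> complex \<Rightarrow> complex" where
  "dirichlet_L chi s = (\<Sum>n. chi (int (Suc n)) / of_nat (Suc n) powr s)"

definition L_logderiv :: "(int \<Rightarrow> complex) \<Rightarrow> complex \<Rightarrow> complex" where
  "L_logderiv chi s = deriv (dirichlet_L chi) s / dirichlet_L chi s"

text \<open>The argument \<open>r\<close> is the remainder denoted \<open>O(1)\<close> in the formula for this coefficient.\<close>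

definition coeff_c0 :: "nat \<Rightarrow> nat \<Rightarrow> (int \<Rightarrow> complex) \<Rightarrow> real \<Rightarrow> complex \<Rightarrow> complex" where
  "coeff_c0 M N chi T r =
     (of_real (ln (real N ^ 2 / real M)
        + 4 * Re (L_logderiv (\<lambda>n. cnj (chi n)) (Complex 1 (2 * T)))) + r)
     / Y0_inner M (\<lambda>_. 1) (\<lambda>_. 1)"

definition coeff_c1 :: "nat \<Rightarrow> complex" where
  "coeff_c1 M = dirichlet_L (principal_character 1) 2 / dirichlet_L (principal_character M) 2
     * (1 / of_nat M - 1 / of_nat M ^ 2)"

definition coeff_cM :: "nat \<Rightarrow> complex" where
  "coeff_cM M = coeff_c1 M"

end

theory Submission
  imports Defs
begin

text \<open>
  Unfolding gives \<open>\<langle>F, \<phi>\<^sub>j\<rangle> = \<integral> F(g\<^sub>j w) \<phi>\<^sub>0(w) d\<mu>(w)\<close> over the standard domain, so everything reduces to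
  bounding \<open>G\<close> at \<open>g\<^sub>j w\<close> and at \<open>M g\<^sub>j w\<close> for \<open>w\<close> in the compact support of \<open>\<phi>\<^sub>0\<close>.  As \<open>G(z)\<close> is the
  limit of \<open>E(z,s) - (3/\<pi>)/(s-1)\<close> as \<open>s\<close> decreases to \<open>1\<close>, it is bounded uniformly on all \<open>z\<close> whose
  quadratic form \<open>\<bar>c z + d\<bar>\<^sup>2 / Im z\<close> stays above a fixed \<open>m > 0\<close> on nonzero integer vectors: the
  form represents \<open>\<pi> t + O\<^sub>m(\<surd>t + 1)\<close> vectors with value at most \<open>t\<close>.  At \<open>g\<^sub>j w\<close> this always holds.
  At \<open>M g\<^sub>j w\<close> it fails only if the bottom row of \<open>g\<^sub>j\<close> is proportional modulo \<open>M\<close> to an integer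
  vector of length below \<open>\<surd>M / 4\<close>; each such vector excludes one coset, and there are at most
  \<open>M / 2\<close> of them.  The statement on \<open>c\<^sub>0\<close> is the computation \<open>\<langle>1,1\<rangle>\<^sub>M = (M + 1) \<pi> / 3\<close>.
\<close>

section \<open>Counting lattice points in ellipses\<close>

text \<open>Some cosets have to be dropped: \<open>G\<close> grows like Im z towards the cusp, and
  for a representative such as the identity the point \<open>M * g w\<close> has height of order
  \<open>M\<close>, so that \<open>G\<close> is of order \<open>M\<close> there. Staying above
  \<open>m\<close> on nonzero vectors means that the unimodular lattice has no short vector, which
  confines it to a compact part of the space of lattices; this is why one constant serves all of
  them. The compactness is made quantitative: a change of basis brings the imaginary part above 1/5,
  and the value of the form at \<open>(0, 1)\<close> then keeps it below 1/m. The value m = 1/(32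
  Y), where \<open>Y\<close> bounds the heights in the support, combines 1/16 from the cut-off for
  short vectors with 1/(2 Y) from comparing the form with the Euclidean norm.
  \<open>Y0_domain\<close> selects its own coset representatives, tied to the given ones only by
  lying in the same cosets, so invariance of the measure is needed even for areas and for the L1
  norm.\<close>

definition lat :: "complex \<Rightarrow> int \<times> int \<Rightarrow> complex" where
  "lat w v = of_int (fst v) * w + of_int (snd v)"

text \<open>The positive definite binary form of determinant 1 attached to \<open>w\<close>. Its
  power with exponent \<open>-s\<close> is the summand of the Eisenstein series, and integral
  changes of basis permute its values.\<close>

definition qform :: "complex \<Rightarrow> int \<times> int \<Rightarrow> real" where
  "qform w v = (norm (lat w v))\<^sup>2 / Im w"

lemma Re_lat [simp]: "Re (lat w v) = of_int (fst v) * Re w + of_int (snd v)"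
  and Im_lat [simp]: "Im (lat w v) = of_int (fst v) * Im w"
  by (simp_all add: lat_def)

lemma lat_eq_0_iff: "Im w > 0 \<Longrightarrow> lat w v = 0 \<longleftrightarrow> v = (0, 0)"
  by (cases v) (auto simp: complex_eq_iff)

lemma qform_pos: "Im w > 0 \<Longrightarrow> v \<noteq> (0, 0) \<Longrightarrow> qform w v > 0"
  by (simp add: qform_def lat_eq_0_iff)

text \<open>These axis-parallel boxes tile the plane, row by row, for every lattice containing \<open>1\<close>; unlike
  the fundamental parallelogram they have an obvious area.\<close>

definition brick :: "complex \<Rightarrow> int \<times> int \<Rightarrow> complex set" where
  "brick w v = {z. Im (lat w v) \<le> Im z \<and> Im z < Im (lat w v) + Im w \<and>
                   Re (lat w v) \<le> Re z \<and> Re z < Re (lat w v) + 1}"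

text \<open>The half-open box lies between the open and the closed box on the same corners, and
  these have equal area.\<close>

lemma measure_brick:
  assumes "Im w > 0"
  shows "brick w v \<in> fmeasurable lborel" "measure lborel (brick w v) = Im w"
proof -
  let ?l = "lat w v" and ?u = "lat w v + Complex 1 (Im w)"
  have bounds: "box ?l ?u \<subseteq> brick w v" "brick w v \<subseteq> cbox ?l ?u"
    by (auto simp: brick_def box_def cbox_def Basis_complex_def)
  have [measurable]: "brick w v \<in> sets borel"
    unfolding brick_def by measurable
  show fm: "brick w v \<in> fmeasurable lborel"
    by (rule fmeasurableI2[OF fmeasurable_cbox bounds(2)]) simp
  have vol: "measure lborel (box ?l ?u) = Im w" "measure lborel (cbox ?l ?u) = Im w"
    using assms by (simp_all add: measure_lborel_box_eq measure_lborel_cbox_eq Basis_complex_def)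
  show "measure lborel (brick w v) = Im w"
    using measure_mono_fmeasurable[OF bounds(1) _ fm] measure_mono_fmeasurable[OF bounds(2) _ fmeasurable_cbox] vol
    by force
qed

text \<open>Overlap in height forces equal first coordinates, since Im w cancels. Lattice points
  with equal first coordinate differ by an integer, so boxes of length 1 in that row are
  disjoint.\<close>

lemma brick_disjoint:
  assumes "Im w > 0" "v \<noteq> v'"
  shows "brick w v \<inter> brick w v' = {}"
proof (rule ccontr)
  assume "brick w v \<inter> brick w v' \<noteq> {}"
  then obtain z where z: "z \<in> brick w v" "z \<in> brick w v'" by blast
  define a b where "a = fst v" and "b = fst v'"
  have "of_int a * Im w < (of_int b + 1) * Im w" "of_int b * Im w < (of_int a + 1) * Im w"
    using z by (auto simp: brick_def a_def b_def algebra_simps)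
  then have "(of_int a :: real) < of_int b + 1" "(of_int b :: real) < of_int a + 1"
    using assms(1) by (simp_all only: mult_less_cancel_right_pos)
  then have ab: "a = b" by linarith
  have "(of_int (snd v) :: real) < of_int (snd v') + 1" "(of_int (snd v') :: real) < of_int (snd v) + 1"
    using z ab by (auto simp: brick_def a_def b_def)
  then have "snd v = snd v'" by linarith
  with ab assms(2) show False
    by (auto simp: a_def b_def prod_eq_iff)
qed

lemma brick_norm_diff:
  assumes "Im w > 0" "z \<in> brick w v"
  shows "norm (z - lat w v) \<le> 1 + Im w"
proof -
  have "norm (z - lat w v) \<le> \<bar>Re (z - lat w v)\<bar> + \<bar>Im (z - lat w v)\<bar>"
    by (rule cmod_le)
  also have "\<dots> \<le> 1 + Im w"
    using assms by (auto simp: brick_def)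
  finally show ?thesis .
qed

lemma ex_brick:
  assumes "Im w > 0"
  obtains v where "z \<in> brick w v"
proof
  define c where "c = \<lfloor>Im z / Im w\<rfloor>"
  define d where "d = \<lfloor>Re z - of_int c * Re w\<rfloor>"
  have "of_int c \<le> Im z / Im w" "Im z / Im w < of_int c + 1"
    unfolding c_def by linarith+
  then have "of_int c * Im w \<le> Im z" "Im z < (of_int c + 1) * Im w"
    using assms by (simp_all add: pos_le_divide_eq pos_divide_less_eq)
  moreover have "of_int d \<le> Re z - of_int c * Re w" "Re z - of_int c * Re w < of_int d + 1"
    unfolding d_def by linarith+
  ultimately show "z \<in> brick w (c, d)"
    by (auto simp: brick_def algebra_simps)
qed

lemma measure_ball_complex: "r \<ge> 0 \<Longrightarrow> measure lborel (ball (0::complex) r) = pi * r\<^sup>2"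
  "r \<ge> 0 \<Longrightarrow> measure lborel (cball (0::complex) r) = pi * r\<^sup>2"
  by (simp_all add: content_ball content_cball unit_ball_vol_2)

text \<open>The bricks of the lattice points in the disc of radius \<open>R\<close> are disjoint,
  stay inside radius \<open>R + D\<close> and cover radius \<open>R - D\<close>, as \<open>D\<close>
  bounds the distance from a lattice point to any point of its brick. Comparing areas gives both
  estimates.\<close>

lemma lattice_count:
  assumes y: "Im w > 0" and R: "R \<ge> 0"
  defines "D \<equiv> 1 + Im w" and "S \<equiv> {v. norm (lat w v) \<le> R}"
  shows "finite S" "real (card S) * Im w \<le> pi * (R + D)\<^sup>2"
    "R \<ge> D \<Longrightarrow> pi * (R - D)\<^sup>2 \<le> real (card S) * Im w"
proof -
  have vol: "measure lborel (\<Union>v\<in>F. brick w v) = real (card F) * Im w" if "finite F" for F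
  proof -
    have "measure lborel (\<Union>v\<in>F. brick w v) = (\<Sum>v\<in>F. measure lborel (brick w v))"
      using brick_disjoint[OF y]
      by (intro measure_UNION' that measure_brick y) (auto simp: pairwise_def disjnt_def)
    then show ?thesis by (simp add: measure_brick[OF y])
  qed
  have upper: "real (card F) * Im w \<le> pi * (R + D)\<^sup>2" if F: "finite F" "F \<subseteq> S" for F
  proof -
    have "z \<in> cball 0 (R + D)" if "v \<in> F" "z \<in> brick w v" for v z
      using norm_triangle_ineq[of "lat w v" "z - lat w v"] brick_norm_diff[OF y that(2)] that F
      by (auto simp: S_def D_def)
    then have "(\<Union>v\<in>F. brick w v) \<subseteq> cball 0 (R + D)"
      by blast
    then have "measure lborel (\<Union>v\<in>F. brick w v) \<le> measure lborel (cball (0::complex) (R + D))"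
      using F measure_brick[OF y] by (intro measure_mono_fmeasurable fmeasurableD[OF fmeasurable.finite_UN]) (auto intro: fmeasurable_compact)
    with R y F show ?thesis
      by (simp add: vol measure_ball_complex D_def)
  qed
  \<comment> \<open>The area bound limits the size of all finite subsets uniformly, and this forces
    \<open>S\<close> itself to be finite.\<close>
  have "card F \<le> nat \<lceil>pi * (R + D)\<^sup>2 / Im w\<rceil>" if "finite F" "F \<subseteq> S" for F
  proof -
    have "real (card F) \<le> pi * (R + D)\<^sup>2 / Im w"
      using upper[OF that] y by (simp add: pos_le_divide_eq)
    then show ?thesis by (metis ceiling_mono ceiling_of_nat nat_int nat_mono)
  qed
  then show fin: "finite S"
    using finite_if_finite_subsets_card_bdd[of S] by metis
  then show "real (card S) * Im w \<le> pi * (R + D)\<^sup>2"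
    by (rule upper) simp
  show "pi * (R - D)\<^sup>2 \<le> real (card S) * Im w" if "R \<ge> D"
  proof -
    have "ball 0 (R - D) \<subseteq> (\<Union>v\<in>S. brick w v)"
    proof
      fix z :: complex assume z: "z \<in> ball 0 (R - D)"
      obtain v where v: "z \<in> brick w v" using ex_brick[OF y] .
      have "norm (lat w v) \<le> R"
        using norm_triangle_ineq4[of z "z - lat w v"] brick_norm_diff[OF y v] z
        by (auto simp: D_def)
      then show "z \<in> (\<Union>v\<in>S. brick w v)"
        using v unfolding S_def by blast
    qed
    then have "measure lborel (ball (0::complex) (R - D)) \<le> measure lborel (\<Union>v\<in>S. brick w v)"
      using fin measure_brick[OF y] by (intro measure_mono_fmeasurable fmeasurable.finite_UN) auto
    with that fin show ?thesis
      by (simp add: vol measure_ball_complex)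
  qed
qed

section \<open>Counting nonzero vectors by the value of the form\<close>

definition qcount :: "complex \<Rightarrow> real \<Rightarrow> nat" where
  "qcount w t = card {v. v \<noteq> (0, 0) \<and> qform w v \<le> t}"

lemma qform_le_iff:
  assumes "Im w > 0" "t \<ge> 0"
  shows "qform w v \<le> t \<longleftrightarrow> norm (lat w v) \<le> sqrt (t * Im w)"
proof -
  have "norm (lat w v) \<le> sqrt (t * Im w) \<longleftrightarrow> sqrt ((norm (lat w v))\<^sup>2) \<le> sqrt (t * Im w)"
    by simp
  then show ?thesis
    using assms by (simp only: real_sqrt_le_iff) (simp add: qform_def pos_divide_le_eq)
qed

lemma finite_qform_le: 
  assumes "Im w > 0"
  shows "finite {v. v \<noteq> (0, 0) \<and> qform w v \<le> t}"
proof (cases "t \<ge> 0")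
  case True
  have "{v. v \<noteq> (0, 0) \<and> qform w v \<le> t} \<subseteq> {v. norm (lat w v) \<le> sqrt (t * Im w)}"
    using qform_le_iff[OF assms True] by blast
  moreover have "finite {v. norm (lat w v) \<le> sqrt (t * Im w)}"
    using assms True by (intro lattice_count(1)) auto
  ultimately show ?thesis
    by (rule finite_subset)
next
  case False
  then have "\<not> qform w v \<le> t" if "v \<noteq> (0, 0)" for v
    using qform_pos[OF assms that] by linarith
  then have "{v. v \<noteq> (0, 0) \<and> qform w v \<le> t} = {}"
    by blast
  then show ?thesis by (simp only: finite.emptyI)
qed

text \<open>At radius sqrt(t Im w) the area bounds expand to pi t, a term of order sqrt t and a
  constant. \<open>A\<close> majorises the errors for every Im w between \<open>a\<close> and
  \<open>b\<close>; its summand 1 pays for the zero vector, which the disc contains and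
  \<open>qcount\<close> omits.\<close>

lemma qcount_bounds:
  fixes a b :: real
  assumes a: "0 < a" "a \<le> Im w" "Im w \<le> b" and t: "t \<ge> 0"
  defines "A \<equiv> 2 * pi * (1 + b) / sqrt a + pi * (1 + b)\<^sup>2 / a + 1"
  shows "real (qcount w t) \<le> pi * t + A * sqrt t + A"
    "pi * t \<le> real (qcount w t) + A * sqrt t + A"
proof -
  define y where "y = Im w"
  define D where "D = 1 + y"
  define S where "S = {v. norm (lat w v) \<le> sqrt (t * y)}"
  have y: "y > 0" "a \<le> y" "y \<le> b" using a by (auto simp: y_def)
  have "S = insert (0, 0) {v. v \<noteq> (0, 0) \<and> qform w v \<le> t}"
    using qform_le_iff[of w t] y t by (auto simp: S_def y_def lat_def)
  then have card: "real (card S) = real (qcount w t) + 1"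
    using finite_qform_le[of w t] y by (simp add: qcount_def y_def)
  note lc = lattice_count[of w "sqrt (t * y)", folded y_def, folded S_def D_def]
  have D: "D \<ge> 0" "D \<le> 1 + b" using y by (auto simp: D_def)
  have A1: "2 * pi * D / sqrt y \<le> 2 * pi * (1 + b) / sqrt a"
    using D y a by (intro frac_le mult_left_mono) auto
  have A2: "pi * D\<^sup>2 / y \<le> pi * (1 + b)\<^sup>2 / a"
    using D y a by (intro frac_le mult_left_mono power_mono) auto
  have A12: "2 * pi * (1 + b) / sqrt a \<ge> 0" "pi * (1 + b)\<^sup>2 / a \<ge> 0" using a by auto
  have sy: "sqrt (t * y) / y = sqrt t / sqrt y" "sqrt (t * y)^2 / y = t"
    using y t by (simp_all add: real_sqrt_mult field_simps)
  have "real (card S) \<le> pi * (sqrt (t * y) + D)\<^sup>2 / y"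
    using lc(2) y t by (simp add: pos_le_divide_eq)
  also have "\<dots> = pi * (sqrt (t * y)^2 / y) + 2 * pi * D * (sqrt (t * y) / y) + pi * D\<^sup>2 / y"
    by (simp add: power2_sum algebra_simps add_divide_distrib)
  also have "\<dots> = pi * t + (2 * pi * D / sqrt y) * sqrt t + pi * D\<^sup>2 / y"
    unfolding sy by simp
  also have "\<dots> \<le> pi * t + (2 * pi * (1 + b) / sqrt a) * sqrt t + pi * (1 + b)\<^sup>2 / a"
    using A1 A2 t by (intro add_mono mult_right_mono order.refl) auto
  also have "\<dots> \<le> pi * t + A * sqrt t + A"
    using t A12 by (intro add_mono mult_right_mono order.refl) (auto simp: A_def)
  finally show "real (qcount w t) \<le> pi * t + A * sqrt t + A"
    using card by simp
  have "pi * t \<le> real (card S) + (2 * pi * D / sqrt y) * sqrt t"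
  proof (cases "sqrt (t * y) \<ge> D")
    case True
    have "pi * t - (2 * pi * D / sqrt y) * sqrt t \<le> pi * t - (2 * pi * D / sqrt y) * sqrt t + pi * D\<^sup>2 / y"
      using y by simp
    also have "\<dots> = pi * (sqrt (t * y)^2 / y) - 2 * pi * D * (sqrt (t * y) / y) + pi * D\<^sup>2 / y"
      unfolding sy by simp
    also have "\<dots> = pi * (sqrt (t * y) - D)\<^sup>2 / y"
      by (simp add: power2_diff algebra_simps add_divide_distrib diff_divide_distrib)
    also have "\<dots> \<le> real (card S)"
      using lc(3) True y t by (simp add: pos_divide_le_eq)
    finally show ?thesis by simp
  next
    case False
    \<comment> \<open>The disc is too small for the lower area bound, but sqrt(t y) < D makes pi t
      itself at most the error term.\<close>
    have "t = sqrt (t * y) * (sqrt t / sqrt y)"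
      using y t by (simp add: real_sqrt_mult)
    also have "\<dots> \<le> D * (sqrt t / sqrt y)"
      using False y t by (intro mult_right_mono) auto
    finally have "pi * t \<le> (pi * D / sqrt y) * sqrt t"
      using mult_left_mono[of t "D * (sqrt t / sqrt y)" pi] by (simp add: mult.assoc)
    also have "\<dots> \<le> (2 * pi * D / sqrt y) * sqrt t"
      using D y t by (intro mult_right_mono divide_right_mono) auto
    finally show ?thesis by simp
  qed
  also have "\<dots> \<le> real (card S) + (2 * pi * (1 + b) / sqrt a) * sqrt t"
    using A1 t by (intro add_left_mono mult_right_mono) auto
  also have "\<dots> \<le> real (card S) + (A - 1) * sqrt t"
    using t A12 by (intro add_left_mono mult_right_mono) (auto simp: A_def)
  finally have "pi * t \<le> real (card S) + (A - 1) * sqrt t" .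
  then show "pi * t \<le> real (qcount w t) + A * sqrt t + A"
  proof -
    have "A \<ge> 1" "sqrt t \<ge> 0" using A12 t by (auto simp: A_def)
    with \<open>pi * t \<le> real (card S) + (A - 1) * sqrt t\<close> card show ?thesis
      by (simp only: left_diff_distrib mult_1)
  qed
qed

section \<open>Lattice sums near their pole\<close>

lemma nn_integral_powr_tail:
  assumes "m > 0" "r > 0"
  shows "(\<integral>\<^sup>+t. ennreal (t powr (- r - 1)) * indicator {m..} t \<partial>lborel) = ennreal (m powr - r / r)"
proof -
  have "((\<lambda>t. - (t powr - r) / r) has_real_derivative t powr (- r - 1)) (at t)" if "m \<le> t" for t
    using that assms by (auto intro!: derivative_eq_intros)
  moreover have "((\<lambda>t. - (t powr - r) / r) \<longlongrightarrow> - 0 / r) at_top"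
    using assms by (intro tendsto_intros tendsto_neg_powr filterlim_ident) auto
  ultimately have "(\<integral>\<^sup>+t. ennreal (t powr (- r - 1)) * indicator {m..} t \<partial>lborel)
      = - 0 / r - (- (m powr - r) / r)"
    by (intro nn_integral_FTC_atLeast) auto
  then show ?thesis by simp
qed

text \<open>The layer-cake form of a power; it turns a sum over vectors into an integral of their
  counting function.\<close>

lemma nn_integral_powr_layer:
  assumes "q > 0" "s > 0"
  shows "(\<integral>\<^sup>+t. ennreal (s * t powr (- s - 1)) * indicator {q..} t \<partial>lborel) = ennreal (q powr - s)"
proof -
  have "(\<integral>\<^sup>+t. ennreal (s * t powr (- s - 1)) * indicator {q..} t \<partial>lborel)
      = (\<integral>\<^sup>+t. ennreal s * (ennreal (t powr (- s - 1)) * indicator {q..} t) \<partial>lborel)"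
    using assms by (intro nn_integral_cong) (simp add: ennreal_mult mult.assoc)
  also have "\<dots> = ennreal s * ennreal (q powr - s / s)"
    by (subst nn_integral_cmult) (simp_all add: nn_integral_powr_tail assms)
  finally show ?thesis
    using assms by (simp flip: ennreal_mult)
qed

text \<open>The Epstein zeta function of the lattice, valued in \<open>ennreal\<close> so that sums
  can be rearranged and interchanged before convergence is known.\<close>

definition lattice_zeta :: "complex \<Rightarrow> real \<Rightarrow> ennreal" where
  "lattice_zeta w s = (\<integral>\<^sup>+v. ennreal (qform w v powr - s) \<partial>count_space (- {(0, 0)}))"

text \<open>Tonelli, applied to the layer-cake form of each summand. The counting function vanishes
  below \<open>m\<close>, so the integral may start there, away from the singularity at 0.\<close>

lemma lattice_zeta_layer:
  assumes w: "Im w > 0" and s: "s > 0" and m: "\<And>v. v \<noteq> (0, 0) \<Longrightarrow> m \<le> qform w v"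
  shows "lattice_zeta w s =
    (\<integral>\<^sup>+t. ennreal (s * t powr (- s - 1) * real (qcount w t)) * indicator {m..} t \<partial>lborel)"
proof -
  let ?g = "\<lambda>t. ennreal (s * t powr (- s - 1))"
  have "lattice_zeta w s = (\<integral>\<^sup>+v. (\<integral>\<^sup>+t. ?g t * indicator {qform w v..} t \<partial>lborel) \<partial>count_space (- {(0, 0)}))"
    unfolding lattice_zeta_def
    by (intro nn_integral_cong) (simp add: nn_integral_powr_layer s qform_pos[OF w])
  also have "\<dots> = (\<integral>\<^sup>+t. (\<integral>\<^sup>+v. ?g t * indicator {qform w v..} t \<partial>count_space (- {(0, 0)})) \<partial>lborel)"
    by (rule nn_integral_count_space_nn_integral[symmetric]) auto
  also have "\<dots> = (\<integral>\<^sup>+t. ennreal (s * t powr (- s - 1) * real (qcount w t)) * indicator {m..} t \<partial>lborel)"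
  proof (rule nn_integral_cong)
    fix t :: real
    define S where "S = {v. v \<noteq> (0, 0) \<and> qform w v \<le> t}"
    have S: "finite S" "S \<subseteq> - {(0, 0)}" "real (card S) = real (qcount w t)"
      using finite_qform_le[OF w] by (auto simp: S_def qcount_def)
    have "(\<integral>\<^sup>+v. ?g t * indicator {qform w v..} t \<partial>count_space (- {(0, 0)}))
        = (\<integral>\<^sup>+v. ?g t * indicator S v \<partial>count_space (- {(0, 0)}))"
      by (intro nn_integral_cong) (simp add: S_def indicator_def)
    also have "\<dots> = ?g t * emeasure (count_space (- {(0, 0)})) S"
      using S by (subst nn_integral_cmult) auto
    also have "\<dots> = ?g t * ennreal (real (qcount w t))"
      using S by (simp add: ennreal_of_nat_eq_real_of_nat)
    also have "\<dots> = ennreal (s * t powr (- s - 1) * real (qcount w t))"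
      using s by (simp add: ennreal_mult')
    also have "\<dots> = \<dots> * indicator {m..} t"
    proof (cases "m \<le> t")
      case False
      have "v \<notin> S" for v
      proof
        assume "v \<in> S"
        then have "v \<noteq> (0, 0)" "qform w v \<le> t" unfolding S_def by blast+
        with m[OF \<open>v \<noteq> (0, 0)\<close>] False show False by linarith
      qed
      then have "S = {}" by blast
      then show ?thesis using S by simp
    qed simp
    finally show "(\<integral>\<^sup>+v. ?g t * indicator {qform w v..} t \<partial>count_space (- {(0, 0)}))
      = ennreal (s * t powr (- s - 1) * real (qcount w t)) * indicator {m..} t" .
  qed
  finally show ?thesis .
qed

text \<open>Partial summation: pi t integrates to the main term with its pole at s = 1, while the
  errors A sqrt t and A give integrals that stay bounded near s = 1.\<close>

lemma lattice_zeta_estimate: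
  assumes w: "Im w > 0" and s: "s > 1" and m: "m > 0" "\<And>v. v \<noteq> (0, 0) \<Longrightarrow> m \<le> qform w v"
    and A: "A \<ge> 0" "\<And>t. t \<ge> 0 \<Longrightarrow> real (qcount w t) \<le> pi * t + A * sqrt t + A"
      "\<And>t. t \<ge> 0 \<Longrightarrow> pi * t \<le> real (qcount w t) + A * sqrt t + A"
  obtains z where "lattice_zeta w s = ennreal z" "z \<ge> 0"
    "\<bar>z - s * pi * (m powr (1 - s) / (s - 1))\<bar>
      \<le> s * A * (m powr (1/2 - s) / (s - 1/2)) + s * A * (m powr - s / s)"
proof -
  define P where "P = s * pi * (m powr (1 - s) / (s - 1))"
  define Q where "Q = s * A * (m powr (1/2 - s) / (s - 1/2)) + s * A * (m powr - s / s)"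
  have PQ: "P \<ge> 0" "Q \<ge> 0" using s A by (auto simp: P_def Q_def)
  have tail: "(\<integral>\<^sup>+t. ennreal (c * t powr (- r - 1)) * indicator {m..} t \<partial>lborel) = ennreal (c * (m powr - r / r))"
    if "c \<ge> 0" "r > 0" for c r
  proof -
    have "(\<integral>\<^sup>+t. ennreal (c * t powr (- r - 1)) * indicator {m..} t \<partial>lborel)
      = (\<integral>\<^sup>+t. ennreal c * (ennreal (t powr (- r - 1)) * indicator {m..} t) \<partial>lborel)"
      using that by (intro nn_integral_cong) (simp add: ennreal_mult mult.assoc)
    also have "\<dots> = ennreal c * ennreal (m powr - r / r)"
      by (subst nn_integral_cmult) (simp_all add: nn_integral_powr_tail m that)
    finally show ?thesis using that by (simp flip: ennreal_mult)
  qed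
  let ?Z = "\<lambda>t. ennreal (s * t powr (- s - 1) * real (qcount w t)) * indicator {m..} t"
  let ?P = "\<lambda>t. ennreal (s * pi * t powr (- (s - 1) - 1)) * indicator {m..} t"
  let ?Q1 = "\<lambda>t. ennreal (s * A * t powr (- (s - 1/2) - 1)) * indicator {m..} t"
  let ?Q2 = "\<lambda>t. ennreal (s * A * t powr (- s - 1)) * indicator {m..} t"
  have intP: "(\<integral>\<^sup>+t. ?P t \<partial>lborel) = ennreal P"
    using s by (subst tail) (auto simp: P_def)
  have intQ: "(\<integral>\<^sup>+t. ?Q1 t + ?Q2 t \<partial>lborel) = ennreal Q"
  proof -
    have 1: "(\<integral>\<^sup>+t. ?Q1 t \<partial>lborel) = ennreal (s * A * (m powr (1/2 - s) / (s - 1/2)))"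
      using s A by (subst tail) auto
    have 2: "(\<integral>\<^sup>+t. ?Q2 t \<partial>lborel) = ennreal (s * A * (m powr - s / s))"
      using s A by (intro tail) auto
    have "(\<integral>\<^sup>+t. ?Q1 t + ?Q2 t \<partial>lborel) = (\<integral>\<^sup>+t. ?Q1 t \<partial>lborel) + (\<integral>\<^sup>+t. ?Q2 t \<partial>lborel)"
      by (rule nn_integral_add) auto
    also have "\<dots> = ennreal Q"
      unfolding 1 2 Q_def using s A by (intro ennreal_plus[symmetric]) auto
    finally show ?thesis .
  qed
  have Z: "lattice_zeta w s = (\<integral>\<^sup>+t. ?Z t \<partial>lborel)"
    using s by (intro lattice_zeta_layer w m) auto
  have powr_eqs: "t * t powr (- s - 1) = t powr (- (s - 1) - 1)"
    "sqrt t * t powr (- s - 1) = t powr (- (s - 1/2) - 1)" if "t > 0" for t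
    using that by (simp_all add: powr_half_sqrt[symmetric] powr_mult_base flip: powr_add)
  have "lattice_zeta w s \<le> (\<integral>\<^sup>+t. ?P t + (?Q1 t + ?Q2 t) \<partial>lborel)"
    unfolding Z
  proof (rule nn_integral_mono)
    fix t :: real
    show "?Z t \<le> ?P t + (?Q1 t + ?Q2 t)"
    proof (cases "m \<le> t")
      case True
      with m have t: "t > 0" by linarith
      have "s * t powr (- s - 1) * real (qcount w t) \<le> s * t powr (- s - 1) * (pi * t + A * sqrt t + A)"
        using s t A by (intro mult_left_mono) auto
      also have "\<dots> = s * pi * (t * t powr (- s - 1)) + (s * A * (sqrt t * t powr (- s - 1)) + s * A * t powr (- s - 1))"
        by (simp add: algebra_simps)
      finally show ?thesis
        using True s A unfolding powr_eqs[OF t] by (simp flip: ennreal_plus add: ennreal_leI)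
    qed simp
  qed
  also have "\<dots> = ennreal P + ennreal Q"
    by (subst nn_integral_add) (use intP intQ in auto)
  finally have up: "lattice_zeta w s \<le> ennreal (P + Q)"
    using PQ by simp
  then obtain z where z: "lattice_zeta w s = ennreal z" "z \<ge> 0"
    by (metis ennreal_cases ennreal_neq_top top.extremum_uniqueI)
  \<comment> \<open>The error is added to the counting side because subtraction in
    \<open>ennreal\<close> truncates at 0.\<close>
  have "ennreal P \<le> (\<integral>\<^sup>+t. ?Z t + (?Q1 t + ?Q2 t) \<partial>lborel)"
    unfolding intP[symmetric]
  proof (rule nn_integral_mono)
    fix t :: real
    show "?P t \<le> ?Z t + (?Q1 t + ?Q2 t)"
    proof (cases "m \<le> t")
      case True
      with m have t: "t > 0" by linarith
      have "s * pi * (t * t powr (- s - 1)) = s * t powr (- s - 1) * (pi * t)"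
        by (simp add: algebra_simps)
      also have "\<dots> \<le> s * t powr (- s - 1) * (real (qcount w t) + A * sqrt t + A)"
        using s t A by (intro mult_left_mono) auto
      also have "\<dots> = s * t powr (- s - 1) * real (qcount w t) + (s * A * (sqrt t * t powr (- s - 1)) + s * A * t powr (- s - 1))"
        by (simp add: algebra_simps)
      finally show ?thesis
        using True s A unfolding powr_eqs[OF t] by (simp flip: ennreal_plus add: ennreal_leI)
    qed simp
  qed
  also have "\<dots> = lattice_zeta w s + ennreal Q"
  proof (subst nn_integral_add)
    show "?Z \<in> borel_measurable lborel"
    proof -
      have "mono (qcount w)"
        unfolding qcount_def by (intro monoI card_mono finite_qform_le[OF w]) auto
      then have "mono (\<lambda>t. real (qcount w t))"
        by (simp add: mono_def)
      then have [measurable]: "(\<lambda>t. real (qcount w t)) \<in> borel_measurable borel"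
        by (rule borel_measurable_mono)
      show ?thesis by measurable
    qed
  qed (use Z intQ in auto)
  finally have "P \<le> z + Q"
    using z PQ by (simp flip: ennreal_plus)
  moreover have "z \<le> P + Q"
    using up PQ unfolding z(1) by (subst (asm) ennreal_le_iff) auto
  ultimately show ?thesis
    using that z unfolding P_def Q_def by (auto simp: abs_le_iff)
qed

section \<open>Reduction of the lattice and the pole of its zeta function\<close>

lemma complex_Im_quotient:
  fixes a b c d :: real
  shows "Im ((of_real a * w + of_real b) / (of_real c * w + of_real d)) =
    (a * d - b * c) * Im w / (norm (of_real c * w + of_real d))\<^sup>2"
  by (simp add: Im_divide cmod_power2 algebra_simps)

text \<open>Every unimodular planar lattice has a primitive vector of bounded length (by Dirichlet's
  approximation theorem); taking it as second basis vector bounds the imaginary part from below.\<close>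

lemma lattice_reduction:
  assumes w: "Im w > 0"
  obtains w' \<sigma> where "Im w' \<ge> 1/5" "bij_betw \<sigma> (- {(0, 0)}) (- {(0, 0)})"
    "\<forall>v. qform w (\<sigma> v) = qform w' v"
proof (cases "Im w \<ge> 1/5")
  case True
  show ?thesis by (rule that[of w "\<lambda>v. v"]) (use True in \<open>auto simp: bij_betw_def\<close>)
next
  case False
  define y where "y = Im w"
  have y: "0 < y" "y < 1" using w False by (auto simp: y_def)
  \<comment> \<open>This length balances the two coordinates: Dirichlet gives |k Re w - h| < 1/N
    \<le> 2 sqrt y, and k \<le> N gives k y \<le> sqrt y. Hence n^2 \<le> 4 y + y, the origin of
    1/5.\<close>
  define N where "N = nat \<lfloor>1 / sqrt y\<rfloor>"
  have "1 / sqrt y \<ge> 1" using y by (simp add: real_le_lsqrt)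
  then have N: "N \<ge> 1" "real N \<le> 1 / sqrt y" "1 / sqrt y < real N + 1"
    unfolding N_def by linarith+
  obtain h k where hk: "coprime h k" "0 < k" "k \<le> int N" "\<bar>of_int k * Re w - of_int h\<bar> < 1 / real N"
    using Dirichlet_approx_coprime[of N "Re w"] N by auto
  define c d where "c = k" and "d = - h"
  have "coprime c d" using hk by (simp add: c_def d_def coprime_commute)
  then obtain u v where uv: "u * c + v * d = 1"
    using bezout_int[of c d] by auto
  define a b where "a = v" and "b = - u"
  have det: "a * d - b * c = 1" using uv by (simp add: a_def b_def)
  define n where "n = norm (of_int c * w + of_int d)"
  have "c \<noteq> 0" using hk by (simp add: c_def)
  then have cw: "of_int c * w + of_int d \<noteq> 0"
    using w by (auto simp: complex_eq_iff)
  then have "n > 0" by (simp add: n_def)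
  have "n\<^sup>2 \<le> 5 * y"
  proof -
    have "(of_int k * Re w - of_int h)\<^sup>2 \<le> (1 / real N)\<^sup>2"
      using hk by (intro abs_le_square_iff[THEN iffD1]) simp
    also have "\<dots> \<le> (2 * sqrt y)\<^sup>2"
    proof (rule power_mono)
      have "1 / sqrt y \<le> 2 * real N" using N by linarith
      then show "1 / real N \<le> 2 * sqrt y" using N y by (simp add: field_simps)
    qed simp
    finally have 1: "(of_int k * Re w - of_int h)\<^sup>2 \<le> 4 * y"
      using y by (simp add: power_mult_distrib)
    have "real_of_int k \<le> 1 / sqrt y" using hk N by linarith
    then have "of_int k * sqrt y \<le> 1" using y by (simp add: field_simps)
    then have "(of_int k * sqrt y)\<^sup>2 \<le> 1\<^sup>2" using hk y by (intro power_mono) auto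
    then have "(of_int k)\<^sup>2 * y \<le> 1" using y by (simp add: power_mult_distrib)
    then have 2: "(of_int k * y)\<^sup>2 \<le> y"
      using y mult_right_mono[of "(of_int k)\<^sup>2 * y" 1 y]
      by (simp add: power2_eq_square mult_ac)
    have "n\<^sup>2 = (of_int k * Re w - of_int h)\<^sup>2 + (of_int k * y)\<^sup>2"
      by (simp add: n_def cmod_power2 c_def d_def y_def)
    with 1 2 show ?thesis by linarith
  qed
  define w' where "w' = (of_int a * w + of_int b) / (of_int c * w + of_int d)"
  have w': "Im w' = y / n\<^sup>2"
    using complex_Im_quotient[of a w b c d] arg_cong[OF det, of real_of_int]
    by (simp add: w'_def y_def n_def)
  \<comment> \<open>Row vectors times the matrix with rows (a, b) and (c, d); \<open>\<tau>\<close>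
    multiplies by its inverse.\<close>
  define \<sigma> where "\<sigma> = (\<lambda>(p, q). (p * a + q * c, p * b + q * d))"
  define \<tau> where "\<tau> = (\<lambda>(r, s). (r * d - s * c, s * a - r * b))"
  have "p * a * d + q * c * d - (p * b * c + q * d * c) = p"
    "(p * b + q * d) * a - (p * a + q * c) * b = q" for p q
  proof -
    have "p * a * d + q * c * d - (p * b * c + q * d * c) = p * (a * d - b * c)"
      by (simp add: algebra_simps)
    then show "p * a * d + q * c * d - (p * b * c + q * d * c) = p" by (simp add: det)
    have "(p * b + q * d) * a - (p * a + q * c) * b = q * (a * d - b * c)"
      by (simp add: algebra_simps)
    then show "(p * b + q * d) * a - (p * a + q * c) * b = q" by (simp add: det)
  qed
  then have \<tau>\<sigma>: "\<tau> (\<sigma> v) = v" for v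
    by (cases v) (simp add: \<sigma>_def \<tau>_def algebra_simps)
  have \<sigma>\<tau>: "\<sigma> (\<tau> v) = v" for v
  proof (cases v)
    case (Pair r s)
    have "(r * d - s * c) * a + (s * a - r * b) * c = r * (a * d - b * c)"
      "(r * d - s * c) * b + (s * a - r * b) * d = s * (a * d - b * c)"
      by (simp_all add: algebra_simps)
    then show ?thesis by (simp add: Pair \<sigma>_def \<tau>_def det)
  qed
  show ?thesis
  proof (rule that)
    show "Im w' \<ge> 1/5"
      using \<open>n\<^sup>2 \<le> 5 * y\<close> \<open>n > 0\<close> y by (simp add: w' field_simps)
    have "\<sigma> (0, 0) = (0, 0)" "\<tau> (0, 0) = (0, 0)" by (simp_all add: \<sigma>_def \<tau>_def)
    then have iff: "\<sigma> v = (0, 0) \<longleftrightarrow> v = (0, 0)" for v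
      using \<tau>\<sigma>[of v] by metis
    show "bij_betw \<sigma> (- {(0, 0)}) (- {(0, 0)})"
    proof (rule bij_betw_imageI)
      show "inj_on \<sigma> (- {(0, 0)})"
        by (rule inj_on_inverseI[where g = \<tau>]) (rule \<tau>\<sigma>)
      show "\<sigma> ` (- {(0, 0)}) = - {(0, 0)}"
      proof (intro equalityI subsetI)
        fix v :: "int \<times> int" assume "v \<in> \<sigma> ` (- {(0, 0)})"
        then obtain u where "v = \<sigma> u" "u \<noteq> (0, 0)" by blast
        with iff[of u] show "v \<in> - {(0, 0)}" by simp
      next
        fix v :: "int \<times> int" assume v: "v \<in> - {(0, 0)}"
        then have "\<tau> v \<in> - {(0, 0)}" using iff[of "\<tau> v"] \<sigma>\<tau>[of v] by simp
        then have "\<sigma> (\<tau> v) \<in> \<sigma> ` (- {(0, 0)})" by (rule imageI)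
        then show "v \<in> \<sigma> ` (- {(0, 0)})" by (simp only: \<sigma>\<tau>)
      qed
    qed
    show "\<forall>v. qform w (\<sigma> v) = qform w' v"
    proof
    fix v
    have "lat w (\<sigma> v) = (of_int c * w + of_int d) * lat w' v"
    proof (cases v)
      case (Pair p q)
      have "(of_int c * w + of_int d) * w' = of_int a * w + of_int b"
        using cw by (simp add: w'_def)
      then have "(of_int c * w + of_int d) * lat w' v =
          of_int p * (of_int a * w + of_int b) + of_int q * (of_int c * w + of_int d)"
        by (simp add: lat_def Pair algebra_simps) (metis (no_types, lifting) distrib_left mult.assoc mult.commute)
      then show ?thesis by (simp add: lat_def Pair \<sigma>_def algebra_simps)
    qed
    then have "(norm (lat w (\<sigma> v)))\<^sup>2 = n\<^sup>2 * (norm (lat w' v))\<^sup>2"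
      by (simp add: norm_mult n_def power_mult_distrib)
    then show "qform w (\<sigma> v) = qform w' v"
      using \<open>n > 0\<close> by (simp add: qform_def w' flip: y_def)
    qed
  qed
qed

text \<open>The sum depends only on the lattice, so \<open>w\<close> may be replaced by the reduced
  \<open>w'\<close>, whose imaginary part lies between 1/5 and 1/m. The constant of the counting
  estimate then depends on \<open>m\<close> alone.\<close>

lemma lattice_zeta_residue:
  assumes m: "0 < m" "m \<le> 1"
  obtains B where "\<And>w s. Im w > 0 \<Longrightarrow> (\<And>v. v \<noteq> (0, 0) \<Longrightarrow> m \<le> qform w v) \<Longrightarrow> 1 < s \<Longrightarrow> s < 2 \<Longrightarrow>
    \<exists>z\<ge>0. lattice_zeta w s = ennreal z \<and> \<bar>z - pi / (s - 1)\<bar> \<le> B"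
proof
  define A where "A = 2 * pi * (1 + 1/m) / sqrt (1/5) + pi * (1 + 1/m)\<^sup>2 / (1/5) + 1"
  have "A \<ge> 0" using m by (simp add: A_def)
  fix w s
  assume w: "Im w > 0" and q: "\<And>v. v \<noteq> (0, 0) \<Longrightarrow> m \<le> qform w v" and s: "1 < s" "s < (2::real)"
  obtain w' \<sigma> where w': "Im w' \<ge> 1/5" and bij: "bij_betw \<sigma> (- {(0, 0)}) (- {(0, 0)})"
    and q\<sigma>: "\<And>v. qform w (\<sigma> v) = qform w' v"
    using lattice_reduction[OF w] by metis
  have Z: "lattice_zeta w s = lattice_zeta w' s"
    unfolding lattice_zeta_def by (subst nn_integral_bij_count_space[OF bij, symmetric]) (simp only: q\<sigma>)
  have q': "m \<le> qform w' v" if "v \<noteq> (0, 0)" for v :: "int \<times> int"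
  proof -
    have "\<sigma> v \<in> - {(0, 0)}" using bij_betwE[OF bij] that by blast
    then show ?thesis using q[of "\<sigma> v"] q\<sigma>[of v] by simp
  qed
  have "qform w' (0, 1) = 1 / Im w'" by (simp add: qform_def lat_def)
  with q'[of "(0, 1)"] w' m have b: "Im w' \<le> 1/m" by (simp add: field_simps)
  have cnt: "real (qcount w' t) \<le> pi * t + A * sqrt t + A" "pi * t \<le> real (qcount w' t) + A * sqrt t + A"
    if "t \<ge> 0" for t
    using qcount_bounds[OF _ w' b that] by (simp_all add: A_def)
  have wpos: "Im w' > 0" using w' by linarith
  define P where "P = s * pi * (m powr (1 - s) / (s - 1))"
  define Q where "Q = s * A * (m powr (1/2 - s) / (s - 1/2)) + s * A * (m powr - s / s)"
  obtain z where z: "lattice_zeta w' s = ennreal z" "z \<ge> 0" "\<bar>z - P\<bar> \<le> Q"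
    using lattice_zeta_estimate[OF wpos s(1) m(1) q' \<open>A \<ge> 0\<close> cnt] unfolding P_def Q_def by blast
  have mono: "m powr e \<le> m powr e'" if "e' \<le> e" for e e'
    using m that by (intro powr_mono') auto
  have m2: "m powr - 2 = 1 / m\<^sup>2" using m by (simp add: powr_minus_divide)
  have "Q \<le> 2 * A * (m powr - 2 / (1/2)) + 2 * A * (m powr - 2 / 1)"
    unfolding Q_def using s \<open>A \<ge> 0\<close>
    by (intro add_mono mult_mono frac_le mono) auto
  then have Q: "Q \<le> 6 * A / m\<^sup>2" by (simp add: m2)
  \<comment> \<open>Now P = pi s exp((s - 1) L) / (s - 1) with L \<ge> 0. It remains to see that s
    exp((s - 1) L) - 1 is O(s - 1) with a constant in \<open>m\<close>; this follows from exp x - 1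
    \<le> x exp x and exp((s - 1) L) \<le> 1/m.\<close>
  define L where "L = - ln m"
  have L: "0 \<le> L" "L \<le> 1 / m"
    using m ln_le_minus_one[of "1/m"] by (simp_all add: L_def ln_div)
  have e: "m powr (1 - s) = exp ((s - 1) * L)"
    using m by (simp add: powr_def L_def algebra_simps)
  have e1: "m powr (1 - s) \<le> 1 / m"
    using mono[of "-1" "1 - s"] s m by (simp add: powr_minus_divide)
  have "0 \<le> (s - 1) * exp ((s - 1) * L)" using s by simp
  moreover have "1 \<le> exp ((s - 1) * L)" using s L by simp
  moreover have "exp ((s - 1) * L) - 1 \<le> (s - 1) * (L * (1 / m))"
  proof -
    define x where "x = (s - 1) * L"
    have "(1 + - x) * exp x \<le> exp (- x) * exp x"
      by (intro mult_right_mono exp_ge_add_one_self) auto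
    also have "\<dots> = 1" by (simp flip: exp_add)
    finally have "exp x - 1 \<le> x * exp x" by (simp add: algebra_simps)
    then have "exp ((s - 1) * L) - 1 \<le> (s - 1) * L * exp ((s - 1) * L)"
      by (simp only: x_def)
    also have "\<dots> \<le> (s - 1) * L * (1 / m)"
      using e e1 s L by (intro mult_left_mono) auto
    finally show ?thesis by simp
  qed
  moreover have "(s - 1) * exp ((s - 1) * L) \<le> (s - 1) * (1 / m)"
    using e e1 s by (intro mult_left_mono) auto
  moreover have "s * exp ((s - 1) * L) - 1 = (s - 1) * exp ((s - 1) * L) + (exp ((s - 1) * L) - 1)"
    by (simp add: algebra_simps)
  ultimately have "0 \<le> s * exp ((s - 1) * L) - 1" "s * exp ((s - 1) * L) - 1 \<le> (s - 1) * (1 / m + L * (1 / m))"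
    unfolding distrib_left by linarith+
  moreover have "L * (1 / m) \<le> 1 / m\<^sup>2"
    using mult_right_mono[OF L(2), of "1/m"] m by (simp add: power2_eq_square)
  moreover have "1 / m \<le> 1 / m\<^sup>2"
    using m by (simp add: field_simps power2_eq_square)
  ultimately have D: "\<bar>s * exp ((s - 1) * L) - 1\<bar> \<le> (s - 1) * (2 / m\<^sup>2)"
    using s by (smt (verit) mult_left_mono add_divide_distrib)
  have "P - pi / (s - 1) = pi * (s * exp ((s - 1) * L) - 1) / (s - 1)"
    by (simp add: P_def e right_diff_distrib diff_divide_distrib mult_ac)
  then have "\<bar>P - pi / (s - 1)\<bar> = pi * (\<bar>s * exp ((s - 1) * L) - 1\<bar> / (s - 1))"
    using s by (simp add: abs_mult)
  also have "\<dots> \<le> pi * (2 / m\<^sup>2)"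
    using D s by (intro mult_left_mono) (auto simp: pos_divide_le_eq mult.commute)
  finally have "\<bar>z - pi / (s - 1)\<bar> \<le> 6 * A / m\<^sup>2 + pi * (2 / m\<^sup>2)"
    using z Q by linarith
  with z Z show "\<exists>z\<ge>0. lattice_zeta w s = ennreal z \<and> \<bar>z - pi / (s - 1)\<bar> \<le> 6 * A / m\<^sup>2 + pi * (2 / m\<^sup>2)"
    by auto
qed

section \<open>The Eisenstein series near its pole\<close>

definition zeta2 :: "real \<Rightarrow> real" where
  "zeta2 s = (\<Sum>n. real (Suc n) powr (- 2 * s))"

lemma summable_Suc_powr: "a < - 1 \<Longrightarrow> summable (\<lambda>n. real (Suc n) powr a)"
  by (subst summable_Suc_iff) (simp add: summable_real_powr_iff)

lemma zeta2_ge_1: "s \<ge> 1 \<Longrightarrow> zeta2 s \<ge> 1"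
  using sum_le_suminf[OF summable_Suc_powr[of "- 2 * s"], of "{0}"] by (simp add: zeta2_def)

lemma zeta2_1: "zeta2 1 = pi\<^sup>2 / 6"
proof -
  have "(\<lambda>n. real (Suc n) powr (- 2)) = (\<lambda>n. 1 / real ((n + 1)\<^sup>2))"
    by (auto simp: fun_eq_iff powr_minus_divide add.commute)
  then show ?thesis
    using sums_unique[OF inverse_squares_sums] by (simp only: zeta2_def mult_1_right)
qed

text \<open>Replacing zeta(2s) by zeta(2) next to a simple pole at s = 1 costs a bounded amount only
  if the difference is O(s - 1). Termwise, 1 - x^(-2(s-1)) \<le> 2 (s - 1) ln x and ln x \<le> 2
  sqrt x leave the summable majorant 4 (s - 1) x^(-3/2).\<close>

lemma zeta2_lipschitz:
  obtains C where "\<And>s. 1 < s \<Longrightarrow> \<bar>zeta2 s - zeta2 1\<bar> \<le> C * (s - 1)"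
proof
  fix s :: real assume s: "1 < s"
  have term_bound: "0 \<le> x powr (- 2) - x powr (- 2 * s)"
    "x powr (- 2) - x powr (- 2 * s) \<le> 4 * (s - 1) * x powr (- 3/2)" if "x \<ge> 1" for x :: real
  proof -
    show "0 \<le> x powr (- 2) - x powr (- 2 * s)"
      using s that by (simp add: powr_mono)
    have "ln x = 2 * ln (sqrt x)"
      using that by (simp add: ln_sqrt)
    also have "\<dots> \<le> 2 * sqrt x"
      using ln_le_minus_one[of "sqrt x"] that by simp
    finally have "ln x \<le> 2 * x powr (1/2)"
      using that by (simp add: powr_half_sqrt)
    have "x powr (- 2) - x powr (- 2 * s) = x powr (- 2) * (1 - x powr (- 2 * (s - 1)))"
      using that by (simp add: right_diff_distrib flip: powr_add)
    also have "\<dots> \<le> x powr (- 2) * (2 * (s - 1) * ln x)"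
      using that exp_ge_add_one_self[of "- 2 * (s - 1) * ln x"]
      by (intro mult_left_mono) (auto simp: powr_def algebra_simps)
    also have "\<dots> \<le> x powr (- 2) * (2 * (s - 1) * (2 * x powr (1/2)))"
      using \<open>ln x \<le> _\<close> s by (intro mult_left_mono) auto
    also have "\<dots> = 4 * (s - 1) * x powr (- 2 + 1/2)"
      using that by (subst powr_add) simp
    finally show "x powr (- 2) - x powr (- 2 * s) \<le> 4 * (s - 1) * x powr (- 3/2)"
      by simp
  qed
  have sm: "summable (\<lambda>n. real (Suc n) powr (- 2))" "summable (\<lambda>n. real (Suc n) powr (- 2 * s))"
    "summable (\<lambda>n. real (Suc n) powr (- 3/2))"
    using s by (intro summable_Suc_powr; simp)+
  have eq: "zeta2 1 - zeta2 s = (\<Sum>n. real (Suc n) powr (- 2) - real (Suc n) powr (- 2 * s))"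
    unfolding zeta2_def using suminf_diff[OF sm(1,2)] by simp
  have nonneg: "0 \<le> zeta2 1 - zeta2 s"
    unfolding eq using sm term_bound by (intro suminf_nonneg summable_diff) auto
  have "zeta2 1 - zeta2 s \<le> (\<Sum>n. 4 * (s - 1) * real (Suc n) powr (- 3/2))"
    unfolding eq using sm term_bound by (intro suminf_le summable_diff summable_mult) auto
  also have "\<dots> = 4 * (s - 1) * (\<Sum>n. real (Suc n) powr (- 3/2))"
    by (rule suminf_mult) (rule sm)
  also have "\<dots> = 4 * (\<Sum>n. real (Suc n) powr (- 3/2)) * (s - 1)"
    by (simp only: mult_ac)
  finally show "\<bar>zeta2 s - zeta2 1\<bar> \<le> 4 * (\<Sum>n. real (Suc n) powr (- 3/2)) * (s - 1)"
    using nonneg by linarith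
qed

section \<open>From all nonzero vectors to the primitive ones\<close>

definition coprime_pairs :: "(int \<times> int) set" where
  "coprime_pairs = {(c, d). coprime c d}"

text \<open>A nonzero vector is its gcd times a unique primitive vector; the index \<open>n\<close>
  stands for the gcd n + 1.\<close>

lemma bij_betw_primitive:
  "bij_betw (\<lambda>(n, c, d). (int (Suc n) * c, int (Suc n) * d)) (UNIV \<times> coprime_pairs) (- {(0, 0)})"
proof (rule bij_betw_imageI)
  let ?h = "\<lambda>(n, c, d). (int (Suc n) * c, int (Suc n) * d)"
  show "inj_on ?h (UNIV \<times> coprime_pairs)"
  proof (rule inj_onI)
    fix x y assume xy: "x \<in> (UNIV :: nat set) \<times> coprime_pairs" "y \<in> (UNIV :: nat set) \<times> coprime_pairs" "?h x = ?h y"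
    obtain n c d where x: "x = (n, c, d)" by (cases x)
    obtain n' c' d' where y: "y = (n', c', d')" by (cases y)
    have gcds: "gcd c d = 1" "gcd c' d' = 1" using xy x y by (auto simp: coprime_pairs_def)
    have eqs: "int (Suc n) * c = int (Suc n') * c'" "int (Suc n) * d = int (Suc n') * d'"
      using xy(3) unfolding x y by simp_all
    have "int (Suc n) * gcd c d = gcd (int (Suc n) * c) (int (Suc n) * d)"
      by (simp only: gcd_mult_left normalize_int_def) simp
    also have "\<dots> = int (Suc n') * gcd c' d'"
      unfolding eqs by (simp only: gcd_mult_left normalize_int_def) simp
    finally have "n = n'" using gcds by simp
    with eqs x y show "x = y" by (simp only: mult_cancel_left prod.inject) simp
  qed
  show "?h ` (UNIV \<times> coprime_pairs) = - {(0, 0)}"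
  proof (intro equalityI subsetI)
    fix v assume "v \<in> ?h ` (UNIV \<times> coprime_pairs)"
    then obtain n c d where v: "v = (int (Suc n) * c, int (Suc n) * d)" and "(c, d) \<in> coprime_pairs"
      by auto
    then have "c \<noteq> 0 \<or> d \<noteq> 0" by (auto simp: coprime_pairs_def)
    then show "v \<in> - {(0, 0)}" unfolding v by (simp del: of_nat_Suc)
  next
    fix v :: "int \<times> int" assume v: "v \<in> - {(0, 0)}"
    obtain a b where ab: "v = (a, b)" by (cases v)
    define g where "g = gcd a b"
    have nz: "a \<noteq> 0 \<or> b \<noteq> 0" using v ab by auto
    then have "g > 0" by (simp add: g_def)
    then have "int (Suc (nat g - 1)) = g" by simp
    moreover have "coprime (a div g) (b div g)" unfolding g_def using nz by (rule div_gcd_coprime)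
    moreover have "g * (a div g) = a" "g * (b div g) = b" by (simp_all add: g_def)
    ultimately show "v \<in> ?h ` (UNIV \<times> coprime_pairs)"
      unfolding ab by (intro image_eqI[of _ _ "(nat g - 1, a div g, b div g)"])
        (simp_all add: coprime_pairs_def del: of_nat_Suc)
  qed
qed

definition primitive_zeta :: "complex \<Rightarrow> real \<Rightarrow> ennreal" where
  "primitive_zeta w s = (\<integral>\<^sup>+v. ennreal (qform w v powr - s) \<partial>count_space coprime_pairs)"

text \<open>The form is homogeneous of degree 2, so the multiple by n + 1 contributes (n + 1)^(-2s)
  and the double sum splits into a product.\<close>

lemma lattice_zeta_eq_zeta2_primitive_zeta:
  assumes w: "Im w > 0" and s: "s > 1"
  shows "lattice_zeta w s = ennreal (zeta2 s) * primitive_zeta w s"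
proof -
  let ?h = "\<lambda>(n, c, d). (int (Suc n) * c, int (Suc n) * d)"
  let ?f = "\<lambda>v. ennreal (qform w v powr - s)"
  let ?z = "\<lambda>n. ennreal (real (Suc n) powr (- 2 * s))"
  have scale: "?f (?h (n, v)) = ?z n * ?f v" if "v \<in> coprime_pairs" for n v
  proof -
    have "v \<noteq> (0, 0)" using that by (auto simp: coprime_pairs_def)
    then have q: "qform w v > 0" by (rule qform_pos[OF w])
    have "lat w (?h (n, v)) = of_nat (Suc n) * lat w v"
      by (cases v) (simp add: lat_def algebra_simps)
    then have "qform w (?h (n, v)) = (real (Suc n))\<^sup>2 * qform w v"
      by (simp add: qform_def norm_mult power_mult_distrib del: of_nat_Suc)
    also have "(real (Suc n))\<^sup>2 = real (Suc n) powr 2" by simp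
    finally have "qform w (?h (n, v)) = real (Suc n) powr 2 * qform w v" .
    then have "qform w (?h (n, v)) powr - s = (real (Suc n) powr 2) powr - s * qform w v powr - s"
      using q by (simp only: powr_mult)
    also have "\<dots> = real (Suc n) powr (- 2 * s) * qform w v powr - s"
      by (simp only: powr_powr mult_minus_right mult_minus_left)
    finally have "qform w (?h (n, v)) powr - s = real (Suc n) powr (- 2 * s) * qform w v powr - s" .
    then show ?thesis by (simp add: ennreal_mult)
  qed
  have "lattice_zeta w s = (\<integral>\<^sup>+x. ?f (?h x) \<partial>count_space (UNIV \<times> coprime_pairs))"
    unfolding lattice_zeta_def by (rule nn_integral_bij_count_space[OF bij_betw_primitive, symmetric])
  also have "\<dots> = (\<integral>\<^sup>+x. ?z (fst x) * ?f (snd x) \<partial>count_space (UNIV \<times> coprime_pairs))"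
    using scale by (intro nn_integral_cong) auto
  also have "\<dots> = (\<integral>\<^sup>+x. ?z (fst x) * ?f (snd x) * indicator (UNIV \<times> coprime_pairs) x \<partial>count_space UNIV)"
    by (rule nn_integral_count_space_indicator) auto
  also have "\<dots> = (\<integral>\<^sup>+n. \<integral>\<^sup>+v. ?z n * ?f v * indicator coprime_pairs v \<partial>count_space UNIV \<partial>count_space UNIV)"
    by (subst nn_integral_fst_count_space[symmetric]) (simp add: indicator_def)
  also have "\<dots> = (\<integral>\<^sup>+n. ?z n * primitive_zeta w s \<partial>count_space UNIV)"
  proof (rule nn_integral_cong)
    fix n
    have "(\<integral>\<^sup>+v. ?z n * ?f v * indicator coprime_pairs v \<partial>count_space UNIV)
      = (\<integral>\<^sup>+v. ?z n * ?f v \<partial>count_space coprime_pairs)"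
      by (rule nn_integral_count_space_indicator[symmetric]) auto
    also have "\<dots> = ?z n * primitive_zeta w s"
      unfolding primitive_zeta_def by (rule nn_integral_cmult) auto
    finally show "(\<integral>\<^sup>+v. ?z n * ?f v * indicator coprime_pairs v \<partial>count_space UNIV) = ?z n * primitive_zeta w s" .
  qed
  also have "\<dots> = (\<integral>\<^sup>+n. ?z n \<partial>count_space UNIV) * primitive_zeta w s"
    by (rule nn_integral_multc) auto
  also have "(\<integral>\<^sup>+n. ?z n \<partial>count_space UNIV) = ennreal (zeta2 s)"
    unfolding nn_integral_count_space_nat zeta2_def
    using s by (intro suminf_ennreal2 summable_Suc_powr) auto
  finally show ?thesis .
qed

text \<open>Finiteness of the nonnegative sum gives absolute summability. This identifies the
  unordered sum in \<open>eisenstein\<close> with an integral over counting measure and rules out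
  its default value 0.\<close>

lemma eisenstein_real:
  assumes w: "Im w > 0" and P: "primitive_zeta w s = ennreal p" "p \<ge> 0"
  shows "eisenstein w (of_real s) = of_real (p / 2)"
proof -
  let ?q = "\<lambda>v. qform w v powr - s"
  have int: "integrable (count_space coprime_pairs) ?q"
    using P by (intro integrableI_nonneg) (auto simp: primitive_zeta_def)
  have "integral\<^sup>L (count_space coprime_pairs) ?q = p"
    using P by (intro integral_eq_nn_integral[THEN trans]) (auto simp: primitive_zeta_def)
  moreover have "Infinite_Set_Sum.abs_summable_on (\<lambda>v. complex_of_real (?q v)) coprime_pairs"
    unfolding abs_summable_on_def using int by (rule integrable_of_real)
  then have "(\<Sum>\<^sub>\<infinity>v\<in>coprime_pairs. complex_of_real (?q v))
      = (\<integral>v. complex_of_real (?q v) \<partial>count_space coprime_pairs)"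
    by (simp only: infsetsum_infsum[symmetric] infsetsum_def)
  ultimately have "(\<Sum>\<^sub>\<infinity>v\<in>coprime_pairs. complex_of_real (?q v)) = of_real p"
    by simp
  moreover have "of_real (Im w) powr of_real s * of_real (norm (of_int c * w + of_int d)) powr (- 2 * of_real s)
      = complex_of_real (?q (c, d))" if "coprime c d" for c d
  proof -
    have "lat w (c, d) \<noteq> 0" using w that by (subst lat_eq_0_iff) auto
    then have n: "norm (lat w (c, d)) > 0" by simp
    have "?q (c, d) = Im w powr s * norm (lat w (c, d)) powr (- 2 * s)"
      using n w by (simp add: qform_def powr_divide powr_powr powr_minus_divide flip: powr_numeral)
    moreover have "of_real (Im w) powr of_real s = complex_of_real (Im w powr s)"
      using w by (simp add: powr_of_real)
    moreover have "of_real (norm (lat w (c, d))) powr of_real (- 2 * s) = complex_of_real (norm (lat w (c, d)) powr (- 2 * s))"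
      by (rule powr_of_real) simp
    ultimately show ?thesis by (simp add: lat_def)
  qed
  ultimately show ?thesis
    unfolding eisenstein_def coprime_pairs_def
    by (subst infsum_cong[where g = "\<lambda>v. complex_of_real (?q v)"]) (auto simp: case_prod_beta)
qed

lemma eisenstein_residue:
  assumes m: "0 < m" "m \<le> 1"
  obtains B where "\<And>w s. Im w > 0 \<Longrightarrow> (\<And>v. v \<noteq> (0, 0) \<Longrightarrow> m \<le> qform w v) \<Longrightarrow> 1 < s \<Longrightarrow> s < 2 \<Longrightarrow>
    norm (eisenstein w (of_real s) - of_real (3 / pi) / (of_real s - 1)) \<le> B"
proof -
  obtain B where B: "\<And>w s. Im w > 0 \<Longrightarrow> (\<And>v. v \<noteq> (0, 0) \<Longrightarrow> m \<le> qform w v) \<Longrightarrow> 1 < s \<Longrightarrow> s < 2 \<Longrightarrow>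
    \<exists>z\<ge>0. lattice_zeta w s = ennreal z \<and> \<bar>z - pi / (s - 1)\<bar> \<le> B"
    using lattice_zeta_residue[OF m] by metis
  obtain C where C: "\<And>s. 1 < s \<Longrightarrow> \<bar>zeta2 s - zeta2 1\<bar> \<le> C * (s - 1)"
    using zeta2_lipschitz by metis
  show ?thesis
  proof (rule that)
    fix w :: complex and s :: real
    assume w: "Im w > 0" and q: "\<And>v. v \<noteq> (0, 0) \<Longrightarrow> m \<le> qform w v" and s: "1 < s" "s < 2"
    obtain z where z: "z \<ge> 0" "lattice_zeta w s = ennreal z" "\<bar>z - pi / (s - 1)\<bar> \<le> B"
      using B[OF w q s] by blast
    define \<zeta> where "\<zeta> = zeta2 s"
    have \<zeta>: "\<zeta> \<ge> 1" using s by (simp add: \<zeta>_def zeta2_ge_1)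
    have prod: "ennreal \<zeta> * primitive_zeta w s = ennreal z"
      using lattice_zeta_eq_zeta2_primitive_zeta[OF w s(1)] z(2) by (simp add: \<zeta>_def)
    obtain p where p: "primitive_zeta w s = ennreal p" "p \<ge> 0"
      using prod \<zeta> by (cases "primitive_zeta w s") (auto simp: ennreal_mult_top)
    have "ennreal (\<zeta> * p) = ennreal z"
      using prod p \<zeta> by (simp add: ennreal_mult)
    then have zp: "z = \<zeta> * p" using \<zeta> p z by simp
    \<comment> \<open>The residue is pi / (2 zeta(2)) = 3 / pi. The first summand carries the error
      of the lattice sum; the second replaces zeta(2s) by zeta(2), and there the Lipschitz bound
      cancels the pole.\<close>
    have "p / 2 - 3 / pi / (s - 1) = (z - pi / (s - 1)) / (2 * \<zeta>) + pi / (s - 1) * (1 / (2 * \<zeta>) - 1 / (2 * zeta2 1))"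
    proof -
      have "pi / (s - 1) * (1 / (2 * zeta2 1)) = 3 / pi / (s - 1)"
        by (simp add: zeta2_1 power2_eq_square)
      moreover have "(z - pi / (s - 1)) / (2 * \<zeta>) = p / 2 - pi / (s - 1) * (1 / (2 * \<zeta>))"
        using \<zeta> by (simp add: zp diff_divide_distrib)
      ultimately show ?thesis by (simp only: right_diff_distrib)
    qed
    moreover have "\<bar>(z - pi / (s - 1)) / (2 * \<zeta>)\<bar> \<le> B"
    proof -
      have "\<bar>z - pi / (s - 1)\<bar> * 1 \<le> \<bar>z - pi / (s - 1)\<bar> * (2 * \<zeta>)"
        using \<zeta> by (intro mult_left_mono) auto
      then show ?thesis using z(3) \<zeta> by (simp add: pos_divide_le_eq)
        (smt (verit) mult_right_mono)
    qed
    moreover have "\<bar>pi / (s - 1) * (1 / (2 * \<zeta>) - 1 / (2 * zeta2 1))\<bar> \<le> pi * C"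
    proof -
      have "\<bar>1 / (2 * \<zeta>) - 1 / (2 * zeta2 1)\<bar> = \<bar>zeta2 1 - \<zeta>\<bar> / (2 * \<zeta> * zeta2 1)"
        using \<zeta> zeta2_ge_1[of 1] by (simp add: field_simps abs_divide abs_mult)
      also have "\<dots> \<le> \<bar>zeta2 1 - \<zeta>\<bar> / 1"
        using \<zeta> zeta2_ge_1[of 1] mult_mono[of 1 \<zeta> 1 "zeta2 1"] by (intro divide_left_mono) auto
      also have "\<dots> \<le> C * (s - 1)" using C[OF s(1)] by (simp add: \<zeta>_def abs_minus_commute)
      finally have "pi / (s - 1) * \<bar>1 / (2 * \<zeta>) - 1 / (2 * zeta2 1)\<bar> \<le> pi / (s - 1) * (C * (s - 1))"
        using s by (intro mult_left_mono) auto
      then show ?thesis using s by (simp add: abs_mult)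
    qed
    ultimately have "\<bar>p / 2 - 3 / pi / (s - 1)\<bar> \<le> B + pi * C"
      by (simp only: order_trans[OF abs_triangle_ineq add_mono])
    moreover have "eisenstein w (of_real s) - of_real (3 / pi) / (of_real s - 1) = of_real (p / 2 - 3 / pi / (s - 1))"
      by (simp add: eisenstein_real[OF w p])
    ultimately show "norm (eisenstein w (of_real s) - of_real (3 / pi) / (of_real s - 1)) \<le> B + pi * C"
      by (simp only: norm_of_real)
  qed
qed

text \<open>Every continuation agrees with the series at real points to the right of 1, so an
  admissible \<open>w\<close> is a limit of series values and hence the same for all choices of
  \<open>U\<close> and \<open>E\<close>. The shift n + 2 keeps the points below 2, the range of the
  estimates.\<close>

lemma eisenstein_constant_term_limit:
  assumes "eisenstein_continuation z U E"
    and "(\<lambda>s. E s - of_real (3 / pi) / (s - 1) - w) \<in> O[at 1](\<lambda>s. s - 1)"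
  shows "(\<lambda>n. eisenstein z (of_real (1 + 1 / real (n + 2))) - of_real (3 / pi) / (of_real (1 + 1 / real (n + 2)) - 1))
    \<longlonglongrightarrow> w"
proof -
  let ?F = "\<lambda>s. E s - of_real (3 / pi) / (s - 1) - w"
  let ?s = "\<lambda>n. complex_of_real (1 + 1 / real (n + 2))"
  obtain c where "eventually (\<lambda>s. norm (?F s) \<le> c * norm (s - 1)) (at 1)"
    using assms(2) by (elim landau_o.bigE)
  moreover have "((\<lambda>s::complex. c * norm (s - 1)) \<longlongrightarrow> c * norm ((1::complex) - 1)) (at 1)"
    by (intro tendsto_intros)
  ultimately have lim: "(?F \<longlongrightarrow> 0) (at 1)"
    by (intro Lim_null_comparison[of ?F]) auto
  have "(\<lambda>n. 1 + 1 / real (n + 2)) \<longlonglongrightarrow> 1"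
    by real_asymp
  then have "?s \<longlonglongrightarrow> of_real 1"
    by (rule tendsto_of_real)
  moreover have "?s n \<noteq> of_real 1" for n
    by (simp only: of_real_eq_iff) simp
  ultimately have "filterlim ?s (at 1) sequentially"
    unfolding of_real_1 by (intro filterlim_atI always_eventually allI)
  from filterlim_compose[OF lim this] have "(\<lambda>n. ?F (?s n)) \<longlonglongrightarrow> 0" .
  moreover have "E (?s n) = eisenstein z (?s n)" for n
    using assms(1) by (auto simp: eisenstein_continuation_def)
  ultimately show ?thesis
    by (simp add: LIM_zero_iff)
qed

text \<open>Where no continuation exists, \<open>eisenstein_G\<close> takes the fixed junk value of \<open>THE\<close>, so a bound for
  the Eisenstein series on a real interval to the right of \<open>1\<close> suffices.\<close>

lemma eisenstein_G_bound:
  assumes m: "0 < m" "m \<le> 1"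
  obtains B where "\<And>z. Im z > 0 \<Longrightarrow> (\<And>v. v \<noteq> (0, 0) \<Longrightarrow> m \<le> qform z v) \<Longrightarrow> norm (eisenstein_G z) \<le> B"
proof -
  obtain B where B: "\<And>w s. Im w > 0 \<Longrightarrow> (\<And>v. v \<noteq> (0, 0) \<Longrightarrow> m \<le> qform w v) \<Longrightarrow> 1 < s \<Longrightarrow> s < 2 \<Longrightarrow>
    norm (eisenstein w (of_real s) - of_real (3 / pi) / (of_real s - 1)) \<le> B"
    using eisenstein_residue[OF m] by metis
  define junk where "junk = (THE w::complex. False)"
  show ?thesis
  proof (rule that)
    fix z assume z: "Im z > 0" "\<And>v. v \<noteq> (0, 0) \<Longrightarrow> m \<le> qform z v"
    define P where "P = (\<lambda>w. \<exists>U E. eisenstein_continuation z U E \<and>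
      (\<lambda>s. E s - of_real (3 / pi) / (s - 1) - w) \<in> O[at 1](\<lambda>s. s - 1))"
    define X where "X = (\<lambda>n. eisenstein z (of_real (1 + 1 / real (n + 2))) - of_real (3 / pi) / (of_real (1 + 1 / real (n + 2)) - 1))"
    have G: "eisenstein_G z = The P" by (simp add: eisenstein_G_def P_def)
    have lim: "X \<longlonglongrightarrow> w" if "P w" for w
      using that eisenstein_constant_term_limit unfolding P_def X_def by blast
    show "norm (eisenstein_G z) \<le> max B (norm junk)"
    proof (cases "\<exists>w. P w")
      case True
      then obtain w where w: "P w" by blast
      then have "The P = w"
        using lim LIMSEQ_unique by (intro the_equality) blast+
      moreover have "norm (X n) \<le> B" for n
        unfolding X_def using z by (intro B) (auto simp: field_simps)
      then have "norm w \<le> B"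
        using lim[OF w] by (intro Lim_norm_ubound[of sequentially X]) auto
      ultimately show ?thesis using G by simp
    next
      case False
      then have "P = (\<lambda>w. False)" by blast
      then show ?thesis by (simp add: G junk_def)
    qed
  qed
qed

section \<open>Cosets of the congruence subgroup\<close>

no_notation fps_nth (infixl "$" 75)

definition mat22 :: "int \<Rightarrow> int \<Rightarrow> int \<Rightarrow> int \<Rightarrow> int^2^2" where
  "mat22 a b c d = (\<chi> i j. if i = 1 then (if j = 1 then a else b) else (if j = 1 then c else d))"

lemma mat22_nth [simp]:
  "mat22 a b c d $ 1 $ 1 = a" "mat22 a b c d $ 1 $ 2 = b"
  "mat22 a b c d $ 2 $ 1 = c" "mat22 a b c d $ 2 $ 2 = d"
  by (simp_all add: mat22_def)

lemma det_mat22 [simp]: "det (mat22 a b c d) = a * d - b * c"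
  by (simp add: det_2)

lemma mult_nth22:
  fixes A B :: "int^2^2"
  shows "(A ** B) $ i $ j = A $ i $ 1 * B $ 1 $ j + A $ i $ 2 * B $ 2 $ j"
  by (simp add: matrix_matrix_mult_def sum_2)

definition adj22 :: "int^2^2 \<Rightarrow> int^2^2" where
  "adj22 A = mat22 (A$2$2) (- (A$1$2)) (- (A$2$1)) (A$1$1)"

lemma mat_1_eq: "(mat 1 :: int^2^2) = mat22 1 0 0 1"
  by (simp add: vec_eq_iff forall_2 mat_def)

lemma SL2Z_iff: "A \<in> SL2Z \<longleftrightarrow> A$1$1 * A$2$2 - A$1$2 * A$2$1 = 1"
  by (simp add: SL2Z_def det_2)

lemma mat22_in_SL2Z [simp]: "mat22 a b c d \<in> SL2Z \<longleftrightarrow> a * d - b * c = 1"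
  by (simp add: SL2Z_iff)

lemma SL2Z_mult: "A \<in> SL2Z \<Longrightarrow> B \<in> SL2Z \<Longrightarrow> A ** B \<in> SL2Z"
  by (simp add: SL2Z_def det_mul)

lemma adj22_SL2Z: "A \<in> SL2Z \<Longrightarrow> adj22 A \<in> SL2Z"
  by (simp add: SL2Z_iff adj22_def algebra_simps)

lemma adj22_mult:
  assumes "A \<in> SL2Z"
  shows "A ** adj22 A = mat 1" "adj22 A ** A = mat 1"
  using assms by (simp_all add: vec_eq_iff forall_2 mult_nth22 adj22_def mat_1_eq SL2Z_iff algebra_simps)

lemma adj22_nth:
  "adj22 A $ 1 $ 1 = A $ 2 $ 2" "adj22 A $ 1 $ 2 = - (A $ 1 $ 2)"
  "adj22 A $ 2 $ 1 = - (A $ 2 $ 1)" "adj22 A $ 2 $ 2 = A $ 1 $ 1"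
  by (simp_all add: adj22_def)

lemma Gamma0_subset: "Gamma0 M \<subseteq> SL2Z"
  by (auto simp: Gamma0_def)

lemma Gamma0_mult: "A \<in> Gamma0 M \<Longrightarrow> B \<in> Gamma0 M \<Longrightarrow> A ** B \<in> Gamma0 M"
  by (auto simp: Gamma0_def SL2Z_mult mult_nth22)

lemma Gamma0_adj: "A \<in> Gamma0 M \<Longrightarrow> adj22 A \<in> Gamma0 M"
  by (simp add: Gamma0_def adj22_SL2Z adj22_nth)

text \<open>The expression tested for divisibility is the lower-left entry of h times the inverse of
  g. A coset is thus determined by its bottom row modulo \<open>M\<close> up to
  proportionality.\<close>

lemma in_Gamma0_coset_iff:
  assumes "g \<in> SL2Z"
  shows "h \<in> Gamma0_coset M g \<longleftrightarrow> h \<in> SL2Z \<and> int M dvd h$2$1 * g$2$2 - h$2$2 * g$2$1"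
proof
  assume "h \<in> Gamma0_coset M g"
  then obtain t where t: "t \<in> Gamma0 M" "h = t ** g"
    by (auto simp: Gamma0_coset_def)
  have "h$2$1 * g$2$2 - h$2$2 * g$2$1 = t$2$1 * (g$1$1 * g$2$2 - g$1$2 * g$2$1)"
    by (simp add: t mult_nth22 algebra_simps)
  also have "\<dots> = t$2$1" using assms by (simp add: SL2Z_iff)
  finally show "h \<in> SL2Z \<and> int M dvd h$2$1 * g$2$2 - h$2$2 * g$2$1"
    using t assms by (simp add: Gamma0_def SL2Z_mult)
next
  assume h: "h \<in> SL2Z \<and> int M dvd h$2$1 * g$2$2 - h$2$2 * g$2$1"
  have "h ** adj22 g \<in> Gamma0 M"
    using h assms by (simp add: Gamma0_def SL2Z_mult adj22_SL2Z mult_nth22 adj22_nth)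
  moreover have "h = (h ** adj22 g) ** g"
    using assms by (simp add: adj22_mult flip: matrix_mul_assoc)
  ultimately show "h \<in> Gamma0_coset M g"
    unfolding Gamma0_coset_def by blast
qed

lemma Gamma0_coset_self: "g \<in> SL2Z \<Longrightarrow> g \<in> Gamma0_coset M g"
  by (simp add: in_Gamma0_coset_iff mult.commute)

lemma Gamma0_coset_eq:
  assumes "g \<in> SL2Z" "h \<in> Gamma0_coset M g"
  shows "Gamma0_coset M h = Gamma0_coset M g"
proof -
  obtain t where t: "t \<in> Gamma0 M" "h = t ** g"
    using assms by (auto simp: Gamma0_coset_def)
  then have tS: "t \<in> SL2Z" using Gamma0_subset by blast
  have g: "g = adj22 t ** h"
    using tS by (simp add: t matrix_mul_assoc adj22_mult)
  show ?thesis
  proof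
    show "Gamma0_coset M h \<subseteq> Gamma0_coset M g"
    proof
      fix x assume "x \<in> Gamma0_coset M h"
      then obtain u where u: "u \<in> Gamma0 M" "x = u ** h" by (auto simp: Gamma0_coset_def)
      then have "x = (u ** t) ** g" using t by (simp add: matrix_mul_assoc)
      then show "x \<in> Gamma0_coset M g"
        using Gamma0_mult[OF u(1) t(1)] unfolding Gamma0_coset_def by blast
    qed
    show "Gamma0_coset M g \<subseteq> Gamma0_coset M h"
    proof
      fix x assume "x \<in> Gamma0_coset M g"
      then obtain u where u: "u \<in> Gamma0 M" "x = u ** g" by (auto simp: Gamma0_coset_def)
      then have "x = (u ** adj22 t) ** h" using g by (simp add: matrix_mul_assoc)
      then show "x \<in> Gamma0_coset M h"
        using Gamma0_mult[OF u(1) Gamma0_adj[OF t(1)]] unfolding Gamma0_coset_def by blast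
    qed
  qed
qed

lemma coset_rep:
  assumes "c \<in> Gamma0_cosets M"
  shows "(SOME g. g \<in> c) \<in> c" "(SOME g. g \<in> c) \<in> SL2Z" "Gamma0_coset M (SOME g. g \<in> c) = c"
proof -
  obtain g where g: "g \<in> SL2Z" "c = Gamma0_coset M g"
    using assms by (auto simp: Gamma0_cosets_def)
  then show *: "(SOME g. g \<in> c) \<in> c"
    using Gamma0_coset_self by (metis someI_ex)
  then have "(SOME g. g \<in> c) \<in> Gamma0_coset M g" by (simp only: g(2))
  then show "(SOME g. g \<in> c) \<in> SL2Z" "Gamma0_coset M (SOME g. g \<in> c) = c"
    unfolding g(2) using in_Gamma0_coset_iff[OF g(1)] Gamma0_coset_eq[OF g(1)] by blast+
qed

text \<open>Cosets are identified with points of the projective line over the field with \<open>M\<close> elements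
  through the bottom rows \<open>(0 : 1)\<close> and \<open>(1 : k)\<close>.\<close>

lemma index_nu_prime:
  assumes M: "prime M"
  shows "finite (Gamma0_cosets M)" "index_nu M = M + 1"
proof -
  define r where "r k = mat22 0 (-1) 1 (int k)" for k
  define I where "I = mat22 1 0 0 1"
  have rI: "r k \<in> SL2Z" "I \<in> SL2Z" for k by (simp_all add: r_def I_def)
  have "M > 1" using M prime_gt_1_nat by blast
  have eq: "Gamma0_cosets M = insert (Gamma0_coset M I) ((\<lambda>k. Gamma0_coset M (r k)) ` {..<M})"
  proof -
    have "Gamma0_coset M g \<in> insert (Gamma0_coset M I) ((\<lambda>k. Gamma0_coset M (r k)) ` {..<M})"
      if g: "g \<in> SL2Z" for g
    proof (cases "int M dvd g$2$1")
      case True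
      then have "I \<in> Gamma0_coset M g"
        using g by (simp add: in_Gamma0_coset_iff I_def)
      then show ?thesis using Gamma0_coset_eq[OF g] by blast
    next
      case False
      then have "coprime (g$2$1) (int M)"
        using M by (simp add: prime_imp_coprime coprime_commute)
      then obtain x y where xy: "x * g$2$1 + y * int M = 1"
        using bezout_int[of "g$2$1" "int M"] by auto
      \<comment> \<open>\<open>x\<close> inverts the lower-left entry modulo \<open>M\<close>, so
        \<open>k\<close> is the affine coordinate of the bottom row: its second entry divided by its
        first.\<close>
      define k where "k = nat ((g$2$2 * x) mod int M)"
      have k: "int k = (g$2$2 * x) mod int M" "k < M"
        using \<open>M > 1\<close> by (simp_all add: k_def nat_less_iff)
      define l where "l = (g$2$2 * x) div int M"
      have kl: "int k = g$2$2 * x - int M * l"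
        unfolding k l_def by (simp add: minus_mult_div_eq_mod)
      have "g$2$2 - int k * g$2$1 = g$2$2 * (1 - x * g$2$1) + int M * (l * g$2$1)"
        unfolding kl by (simp add: algebra_simps)
      also have "1 - x * g$2$1 = y * int M" using xy by linarith
      finally have "int M dvd g$2$2 - int k * g$2$1" by simp
      then have "r k \<in> Gamma0_coset M g"
        using g rI by (simp add: in_Gamma0_coset_iff r_def)
      then show ?thesis using Gamma0_coset_eq[OF g] k(2) by blast
    qed
    then show ?thesis using rI by (auto simp: Gamma0_cosets_def)
  qed
  then show "finite (Gamma0_cosets M)" by simp
  have "k = l" if "Gamma0_coset M (r k) = Gamma0_coset M (r l)" "k < M" "l < M" for k l
  proof -
    have "r k \<in> Gamma0_coset M (r l)"
      using that Gamma0_coset_self rI by blast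
    then have "int M dvd int l - int k"
      using rI by (simp add: in_Gamma0_coset_iff r_def)
    then have "int l mod int M = int k mod int M"
      by (simp add: mod_eq_dvd_iff)
    then show ?thesis using that by simp
  qed
  then have "inj_on (\<lambda>k. Gamma0_coset M (r k)) {..<M}"
    by (auto simp: inj_on_def)
  moreover have "Gamma0_coset M I \<noteq> Gamma0_coset M (r k)" for k
  proof
    assume "Gamma0_coset M I = Gamma0_coset M (r k)"
    then have "I \<in> Gamma0_coset M (r k)"
      using Gamma0_coset_self rI by blast
    then show False
      using rI \<open>M > 1\<close> by (simp add: in_Gamma0_coset_iff r_def I_def)
  qed
  ultimately show "index_nu M = M + 1"
    unfolding index_nu_def eq by (subst card_insert_disjoint) (auto simp: card_image)
qed

lemma coset_reps_inj:
  assumes "coset_reps M g" "j \<in> {1..index_nu M}" "k \<in> {1..index_nu M}" "g j \<in> Gamma0_coset M (g k)"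
  shows "j = k"
proof (rule ccontr)
  assume "j \<noteq> k"
  then have "Gamma0_coset M (g j) \<inter> Gamma0_coset M (g k) = {}"
    using assms by (simp add: coset_reps_def disjoint_family_on_def)
  moreover have "g j \<in> Gamma0_coset M (g j)"
    using assms by (intro Gamma0_coset_self) (auto simp: coset_reps_def)
  ultimately show False using assms(4) by blast
qed

text \<open>The exceptional cosets are those whose bottom row is proportional modulo \<open>M\<close> to a short
  nonzero integer vector; each such vector spoils at most one coset.\<close>

lemma card_bad_cosets:
  assumes M: "prime M" and g: "coset_reps M g"
  defines "bad \<equiv> {j \<in> {1..index_nu M}. \<exists>p q. (p, q) \<noteq> (0, 0) \<and> 16 * (p\<^sup>2 + q\<^sup>2) < int M \<and>
                     int M dvd p * g j$2$2 - q * g j$2$1}"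
  shows "2 * card bad \<le> M"
proof -
  \<comment> \<open>The disc is enlarged to a square inside [-R, R]^2 with R \<le> sqrt(M) / 4,
    which has at most (2 R + 1)^2 - 1 \<le> 8 R^2 \<le> M / 2 nonzero points. The factor 16 is what
    makes the last inequality hold.\<close>
  define L where "L = {p::int. 16 * p\<^sup>2 < int M}"
  define V where "V = L \<times> L - {(0, 0)}"
  have "M > 1" using M prime_gt_1_nat by blast
  define R where "R = nat \<lfloor>sqrt (M / 16)\<rfloor>"
  have R: "real R \<le> sqrt (M / 16)" by (simp add: R_def)
  have "p \<in> {- int R..int R}" if "p \<in> L" for p
  proof -
    have "real_of_int (16 * p\<^sup>2) < real_of_int (int M)"
      using that unfolding L_def mem_Collect_eq by (rule of_int_less_iff[THEN iffD2])
    then have "\<bar>real_of_int p\<bar> \<le> sqrt (M / 16)"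
      by (intro real_le_rsqrt) simp
    then have "\<lfloor>real_of_int \<bar>p\<bar>\<rfloor> \<le> \<lfloor>sqrt (M / 16)\<rfloor>"
      by (intro floor_mono) simp
    then have "\<bar>p\<bar> \<le> int R" by (simp only: floor_of_int R_def)
    then show ?thesis by (simp add: abs_le_iff)
  qed
  then have L: "L \<subseteq> {- int R..int R}" by blast
  then have finL: "finite L" using finite_subset by blast
  have "card L \<le> 2 * R + 1"
    using card_mono[OF _ L] by simp
  moreover have "(0, 0) \<in> L \<times> L" using \<open>M > 1\<close> by (simp add: L_def)
  then have "card V = card L * card L - 1"
    unfolding V_def using finL by (subst card_Diff_singleton) (auto simp: card_cartesian_product)
  ultimately have "card V \<le> (2 * R + 1) * (2 * R + 1) - 1"
    by (metis diff_le_mono mult_le_mono)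
  also have "\<dots> = 4 * R * R + 4 * R" by (simp add: algebra_simps)
  also have "\<dots> \<le> 8 * (R * R)"
    using le_square[of R] by (simp add: algebra_simps)
  finally have cV: "card V \<le> 8 * (R * R)" .
  have "real R * real R \<le> sqrt (M / 16) * sqrt (M / 16)"
    using R by (intro mult_mono) auto
  then have "16 * (R * R) \<le> M"
    by (simp add: field_simps flip: of_nat_mult)
  with cV have V2: "2 * card V \<le> M" by linarith
  have "\<forall>j\<in>bad. \<exists>v. v \<in> V \<and> int M dvd fst v * g j$2$2 - snd v * g j$2$1"
  proof
    fix j assume "j \<in> bad"
    then obtain p q where pq: "(p, q) \<noteq> (0, 0)" "16 * (p\<^sup>2 + q\<^sup>2) < int M" "int M dvd p * g j$2$2 - q * g j$2$1"
      unfolding bad_def by blast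
    have "16 * a < int M \<and> 16 * b < int M" if "0 \<le> a" "0 \<le> b" "16 * (a + b) < int M" for a b :: int
      using that by presburger
    from this[OF _ _ pq(2)] have "16 * p\<^sup>2 < int M" "16 * q\<^sup>2 < int M" by simp_all
    with pq have "(p, q) \<in> V" by (simp add: V_def L_def)
    with pq show "\<exists>v. v \<in> V \<and> int M dvd fst v * g j$2$2 - snd v * g j$2$1" by force
  qed
  then obtain v where v: "\<And>j. j \<in> bad \<Longrightarrow> v j \<in> V"
      "\<And>j. j \<in> bad \<Longrightarrow> int M dvd fst (v j) * g j$2$2 - snd (v j) * g j$2$1"
    by metis
  have "inj_on v bad"
  proof (rule inj_onI)
    fix j k assume jk: "j \<in> bad" "k \<in> bad" "v j = v k"
    obtain p q where pq: "v j = (p, q)" by (cases "v j")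
    have dj: "int M dvd p * g j$2$2 - q * g j$2$1" and dk: "int M dvd p * g k$2$2 - q * g k$2$1"
      using v(2)[OF jk(1)] v(2)[OF jk(2)] unfolding jk(3)[symmetric] pq by simp_all
    have V: "(p, q) \<noteq> (0, 0)" "16 * p\<^sup>2 < int M" "16 * q\<^sup>2 < int M"
      using v(1)[OF jk(1)] pq by (auto simp: V_def L_def)
    have small: "x = 0" if "16 * x\<^sup>2 < int M" "int M dvd x" for x :: int
    proof (rule ccontr)
      assume "x \<noteq> 0"
      then have "int M \<le> \<bar>x\<bar>" using dvd_imp_le_int[OF _ that(2)] by simp
      also have "\<dots> \<le> x\<^sup>2" using \<open>x \<noteq> 0\<close> self_le_power[of "\<bar>x\<bar>" 2] by simp
      finally show False using that(1) \<open>M > 1\<close> by simp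
    qed
    have pM: "prime (int M)" using M by simp
    \<comment> \<open>The determinant of the two bottom rows. Both rows are proportional to (p, q)
      modulo \<open>M\<close>, so \<open>M\<close> divides its products with p and with q; by
      \<open>small\<close>, \<open>M\<close> cannot divide both p and q.\<close>
    let ?x = "g j$2$1 * g k$2$2 - g j$2$2 * g k$2$1"
    have "p * ?x = g j$2$1 * (p * g k$2$2 - q * g k$2$1) - g k$2$1 * (p * g j$2$2 - q * g j$2$1)"
      "q * ?x = g j$2$2 * (p * g k$2$2 - q * g k$2$1) - g k$2$2 * (p * g j$2$2 - q * g j$2$1)"
      by (simp_all add: algebra_simps)
    then have "int M dvd p * ?x" "int M dvd q * ?x"
      using dj dk by simp_all
    then have "int M dvd ?x"
      using V small pM by (metis prime_dvd_mult_iff)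
    then have "g j \<in> Gamma0_coset M (g k)"
      using g jk by (subst in_Gamma0_coset_iff) (auto simp: coset_reps_def bad_def)
    then show "j = k"
      using coset_reps_inj[OF g] jk by (simp add: bad_def)
  qed
  moreover have "v ` bad \<subseteq> V" using v by blast
  ultimately have "card bad \<le> card V"
    using finL by (intro card_inj_on_le) (auto simp: V_def)
  with V2 show ?thesis by simp
qed

section \<open>Invariance of the hyperbolic measure\<close>

lemma moebius_lat: "moebius A z = lat z (A$1$1, A$1$2) / lat z (A$2$1, A$2$2)"
  by (simp add: moebius_def lat_def)

lemma denom_nonzero:
  assumes "A \<in> SL2Z" "Im z > 0"
  shows "lat z (A$2$1, A$2$2) \<noteq> 0"
proof
  assume "lat z (A$2$1, A$2$2) = 0"
  then have "A$2$1 = 0 \<and> A$2$2 = 0" using assms(2) by (simp add: lat_eq_0_iff)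
  with assms(1) show False by (simp add: SL2Z_iff)
qed

lemma Im_moebius:
  assumes "A \<in> SL2Z"
  shows "Im (moebius A z) = Im z / (norm (lat z (A$2$1, A$2$2)))\<^sup>2"
proof -
  have "real_of_int (A$1$1) * of_int (A$2$2) - of_int (A$1$2) * of_int (A$2$1) = 1"
    using arg_cong[of _ _ real_of_int, OF SL2Z_iff[THEN iffD1, OF assms]] by simp
  then show ?thesis
    using complex_Im_quotient[of "A$1$1" z "A$1$2" "A$2$1" "A$2$2"] by (simp add: moebius_def lat_def)
qed

lemma Im_moebius_pos: "A \<in> SL2Z \<Longrightarrow> Im z > 0 \<Longrightarrow> Im (moebius A z) > 0"
  by (simp add: Im_moebius denom_nonzero)

lemma moebius_in_uhp: "A \<in> SL2Z \<Longrightarrow> z \<in> uhp \<Longrightarrow> moebius A z \<in> uhp"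
  by (simp add: uhp_def Im_moebius_pos)

text \<open>The pair on the right is the row (p, q) times the matrix, and the denominator is the
  automorphy factor. Composition of Moebius maps and the transformation of \<open>qform\<close> both
  come from this.\<close>

lemma lat_moebius:
  assumes "A \<in> SL2Z" "Im z > 0"
  shows "lat (moebius A z) (p, q) = lat z (p * A$1$1 + q * A$2$1, p * A$1$2 + q * A$2$2) / lat z (A$2$1, A$2$2)"
proof -
  have "lat z (A$2$1, A$2$2) * lat (moebius A z) (p, q) =
      of_int p * lat z (A$1$1, A$1$2) + of_int q * lat z (A$2$1, A$2$2)"
    using denom_nonzero[OF assms] by (subst lat_def) (simp add: moebius_lat distrib_left)
  also have "\<dots> = lat z (p * A$1$1 + q * A$2$1, p * A$1$2 + q * A$2$2)"
    by (simp add: lat_def algebra_simps)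
  finally show ?thesis
    using denom_nonzero[OF assms] by (simp add: field_simps)
qed

lemma moebius_mult:
  assumes "B \<in> SL2Z" "Im z > 0"
  shows "moebius (A ** B) z = moebius A (moebius B z)"
  using denom_nonzero[OF assms]
  by (simp add: moebius_lat[of A] moebius_lat[of "A ** B"] lat_moebius[OF assms] mult_nth22)

lemma moebius_1: "moebius (mat 1) z = z"
  by (simp add: moebius_def mat_1_eq)

lemma moebius_adj:
  assumes "A \<in> SL2Z" "Im z > 0"
  shows "moebius (adj22 A) (moebius A z) = z" "moebius A (moebius (adj22 A) z) = z"
  using assms by (simp_all add: moebius_mult[symmetric] adj22_SL2Z adj22_mult moebius_1)

lemma inj_on_moebius: "A \<in> SL2Z \<Longrightarrow> inj_on (moebius A) uhp"
  by (rule inj_on_inverseI[where g = "moebius (adj22 A)"]) (simp add: moebius_adj uhp_def)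

text \<open>Written as a preimage under the inverse map, an image inherits Borel
  measurability.\<close>

lemma moebius_image:
  assumes "A \<in> SL2Z" "X \<subseteq> uhp"
  shows "moebius A ` X = uhp \<inter> moebius (adj22 A) -` X"
proof (intro equalityI subsetI)
  fix z assume "z \<in> moebius A ` X"
  then obtain w where w: "w \<in> X" "z = moebius A w" by blast
  with assms have "w \<in> uhp" by blast
  with w assms show "z \<in> uhp \<inter> moebius (adj22 A) -` X"
    by (simp add: moebius_adj Im_moebius_pos uhp_def)
next
  fix z assume z: "z \<in> uhp \<inter> moebius (adj22 A) -` X"
  then have "z = moebius A (moebius (adj22 A) z)" using assms by (simp add: moebius_adj uhp_def)
  with z show "z \<in> moebius A ` X" by blast
qed

lemma borel_uhp [measurable]: "uhp \<in> sets borel"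
  unfolding uhp_def by measurable

lemma borel_measurable_moebius [measurable]: "moebius A \<in> borel_measurable borel"
  unfolding moebius_def by measurable

lemma borel_moebius_image:
  assumes "A \<in> SL2Z" "X \<subseteq> uhp" "X \<in> sets borel"
  shows "moebius A ` X \<in> sets borel"
proof -
  have "moebius (adj22 A) -` X \<in> sets borel"
    using measurable_sets[OF borel_measurable_moebius assms(3)] by simp
  then show ?thesis unfolding moebius_image[OF assms(1,2)] by simp
qed

section \<open>The Jacobian of a Moebius map in real coordinates\<close>

lemma has_derivative_moebius:
  assumes "A \<in> SL2Z" "Im z > 0"
  shows "(moebius A has_field_derivative 1 / (lat z (A$2$1, A$2$2))\<^sup>2) (at z)"
proof -
  let ?a = "of_int (A$1$1) :: complex" and ?b = "of_int (A$1$2) :: complex"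
    and ?c = "of_int (A$2$1) :: complex" and ?d = "of_int (A$2$2) :: complex"
  have nz: "?c * z + ?d \<noteq> 0" using denom_nonzero[OF assms] by (simp add: lat_def)
  have det: "?a * ?d - ?b * ?c = 1"
    using arg_cong[of _ _ "of_int :: int \<Rightarrow> complex", OF SL2Z_iff[THEN iffD1, OF assms(1)]] by simp
  have "((\<lambda>z. (?a * z + ?b) / (?c * z + ?d)) has_field_derivative
      (?a * (?c * z + ?d) - (?a * z + ?b) * ?c) / ((?c * z + ?d) * (?c * z + ?d))) (at z)"
    using nz by (auto intro!: derivative_eq_intros)
  moreover have "?a * (?c * z + ?d) - (?a * z + ?b) * ?c = 1"
    using det by (simp add: algebra_simps)
  ultimately show ?thesis
    by (simp add: moebius_def[abs_def] lat_def power2_eq_square)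
qed

text \<open>The change of variables formula used below is phrased through determinants on
  \<open>real^n\<close>, hence the identification of the plane with \<open>real^2\<close>.\<close>

definition vec2_to_complex :: "real^2 \<Rightarrow> complex" where "vec2_to_complex v = Complex (v$1) (v$2)"
definition complex_to_vec2 :: "complex \<Rightarrow> real^2" where "complex_to_vec2 z = (\<chi> i. if i = 1 then Re z else Im z)"

lemma vec2_complex_inverse [simp]: "vec2_to_complex (complex_to_vec2 z) = z" "complex_to_vec2 (vec2_to_complex v) = v"
  by (simp_all add: vec2_to_complex_def complex_to_vec2_def vec_eq_iff forall_2)

lemma complex_to_vec2_nth [simp]: "complex_to_vec2 z $ 1 = Re z" "complex_to_vec2 z $ 2 = Im z"
  by (simp_all add: complex_to_vec2_def)

lemma Re_Im_vec2_to_complex [simp]: "Re (vec2_to_complex v) = v $ 1" "Im (vec2_to_complex v) = v $ 2"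
  by (simp_all add: vec2_to_complex_def)

lemma bounded_linear_vec2_to_complex: "bounded_linear vec2_to_complex" and bounded_linear_complex_to_vec2: "bounded_linear complex_to_vec2"
  unfolding linear_conv_bounded_linear[symmetric]
  by (intro linearI; simp add: complex_eq_iff vec_eq_iff forall_2)+

lemma borel_measurable_vec2_to_complex [measurable]: "vec2_to_complex \<in> borel_measurable borel"
  by (intro borel_measurable_continuous_onI linear_continuous_on bounded_linear_vec2_to_complex)

lemma lborel_complex_real2: "(lborel :: complex measure) = distr lborel borel vec2_to_complex"
proof (rule lborel_eqI)
  fix l u :: complex
  assume le: "\<And>b. b \<in> Basis \<Longrightarrow> l \<bullet> b \<le> u \<bullet> b"
  then have le': "Re l \<le> Re u" "Im l \<le> Im u"
    using le[of 1] le[of \<i>] by (auto simp: Basis_complex_def)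
  have "vec2_to_complex -` box l u = box (complex_to_vec2 l) (complex_to_vec2 u)"
    by (auto simp: box_def Basis_complex_def Basis_vec_def cart_eq_inner_axis[symmetric] forall_2)
  then have "emeasure (distr lborel borel vec2_to_complex) (box l u) = emeasure lborel (box (complex_to_vec2 l) (complex_to_vec2 u))"
    by (simp add: emeasure_distr)
  also have "\<dots> = ennreal (\<Prod>b\<in>Basis. (complex_to_vec2 u - complex_to_vec2 l) \<bullet> b)"
  proof (rule emeasure_lborel_box)
    have "\<forall>i. complex_to_vec2 l $ i \<le> complex_to_vec2 u $ i" using le' by (simp add: forall_2)
    then show "complex_to_vec2 l \<bullet> b \<le> complex_to_vec2 u \<bullet> b" if "b \<in> Basis" for b
      using that by (auto simp: Basis_vec_def cart_eq_inner_axis[symmetric])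
  qed
  also have "(\<Prod>b\<in>Basis. (complex_to_vec2 u - complex_to_vec2 l) \<bullet> b) = (\<Prod>i\<in>UNIV. (complex_to_vec2 u - complex_to_vec2 l) $ i)"
    by (simp add: Basis_vec_def cart_eq_inner_axis UNION_singleton_eq_range prod.reindex inj_on_def axis_eq_axis)
  also have "\<dots> = (\<Prod>b\<in>Basis. (u - l) \<bullet> b)"
    by (simp add: UNIV_2 Basis_complex_def)
  finally show "emeasure (distr lborel borel vec2_to_complex) (box l u) = ennreal (\<Prod>b\<in>Basis. (u - l) \<bullet> b)" .
qed simp

text \<open>This form allows iterated integration along vertical lines, as needed for the area of
  the standard domain.\<close>

lemma lborel_complex_pair:
  "(lborel :: complex measure) = distr (lborel \<Otimes>\<^sub>M lborel) borel (\<lambda>(x, y). Complex x y)"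
proof (rule lborel_eqI)
  fix l u :: complex
  assume le: "\<And>b. b \<in> Basis \<Longrightarrow> l \<bullet> b \<le> u \<bullet> b"
  then have le': "Re l \<le> Re u" "Im l \<le> Im u"
    using le[of 1] le[of \<i>] by (auto simp: Basis_complex_def)
  have [measurable]: "(\<lambda>(x, y). Complex x y) \<in> borel_measurable (lborel \<Otimes>\<^sub>M lborel)"
    by (simp add: borel_measurable_complex_iff split_beta)
  have "(\<lambda>(x, y). Complex x y) -` box l u = {Re l<..<Re u} \<times> {Im l<..<Im u}"
    by (auto simp: box_def Basis_complex_def)
  then have "emeasure (distr (lborel \<Otimes>\<^sub>M lborel) borel (\<lambda>(x, y). Complex x y)) (box l u)
      = emeasure (lborel \<Otimes>\<^sub>M lborel) ({Re l<..<Re u} \<times> {Im l<..<Im u})"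
    by (simp add: emeasure_distr space_pair_measure)
  also have "\<dots> = ennreal (Re u - Re l) * ennreal (Im u - Im l)"
    using le' by (simp add: lborel.emeasure_pair_measure_Times)
  also have "\<dots> = ennreal (\<Prod>b\<in>Basis. (u - l) \<bullet> b)"
    using le' by (simp add: Basis_complex_def ennreal_mult)
  finally show "emeasure (distr (lborel \<Otimes>\<^sub>M lborel) borel (\<lambda>(x, y). Complex x y)) (box l u)
      = ennreal (\<Prod>b\<in>Basis. (u - l) \<bullet> b)" .
qed simp

lemma sets_hyp_measure [measurable_cong, simp]: "sets hyp_measure = sets borel"
  and space_hyp_measure [simp]: "space hyp_measure = UNIV"
  by (simp_all add: hyp_measure_def)

lemma emeasure_hyp_real2:
  assumes "X \<in> sets borel" "X \<subseteq> uhp"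
  shows "emeasure hyp_measure X = (\<integral>\<^sup>+v. ennreal (indicator (vec2_to_complex -` X) v / (v $ 2)\<^sup>2) \<partial>lborel)"
proof -
  note [measurable] = assms(1)
  have "emeasure hyp_measure X = (\<integral>\<^sup>+z. ennreal (indicator uhp z / (Im z)\<^sup>2) * indicator X z \<partial>lborel)"
    unfolding hyp_measure_def by (rule emeasure_density) auto
  also have "\<dots> = (\<integral>\<^sup>+v. ennreal (indicator uhp (vec2_to_complex v) / (Im (vec2_to_complex v))\<^sup>2) * indicator X (vec2_to_complex v) \<partial>lborel)"
    by (subst lborel_complex_real2) (simp add: nn_integral_distr)
  also have "\<dots> = (\<integral>\<^sup>+v. ennreal (indicator (vec2_to_complex -` X) v / (v $ 2)\<^sup>2) \<partial>lborel)"
    using assms(2) by (intro nn_integral_cong) (auto simp: indicator_def)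
  finally show ?thesis .
qed

lemma det_complex_mult: "det (matrix (\<lambda>h. complex_to_vec2 (u * vec2_to_complex h))) = (norm u)\<^sup>2"
proof -
  have "det (matrix (\<lambda>h. complex_to_vec2 (u * vec2_to_complex h))) = Re u * Re u + Im u * Im u"
    by (simp add: det_2 matrix_def vec2_to_complex_def axis_def)
  then show ?thesis by (simp only: cmod_power2) (simp only: power2_eq_square)
qed

text \<open>The Jacobian is |c z + d|^(-4), and the density 1/y^2 gains exactly the factor |c z +
  d|^4 because Im (A z) = y / |c z + d|^2. Finite measure allows reading it as a real integral, to
  which change of variables applies.\<close>

lemma emeasure_hyp_moebius:
  assumes A: "A \<in> SL2Z" and X: "X \<in> sets borel" "X \<subseteq> uhp" and fin: "emeasure hyp_measure X < \<infinity>"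
  shows "emeasure hyp_measure (moebius A ` X) = emeasure hyp_measure X"
proof -
  obtain m where m: "emeasure hyp_measure X = ennreal m" "m \<ge> 0"
    using fin by (cases "emeasure hyp_measure X") auto
  define S where "S = vec2_to_complex -` X"
  define g where "g = (\<lambda>v. complex_to_vec2 (moebius A (vec2_to_complex v)))"
  define u where "u = (\<lambda>v. 1 / (lat (vec2_to_complex v) (A$2$1, A$2$2))\<^sup>2)"
  \<comment> \<open>The values lie in \<open>real^1\<close> to fit the vector-valued integrand of
    the change of variables theorem.\<close>
  define f where "f = (\<lambda>v::real^2. (vec (1 / (v $ 2)\<^sup>2) :: real^1))"
  have vimage_borel: "vec2_to_complex -` Y \<in> sets borel" if "Y \<in> sets borel" for Y
    using measurable_sets[OF borel_measurable_vec2_to_complex that] by simp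
  have S: "S \<in> sets borel" unfolding S_def using X(1) by (rule vimage_borel)
  have Im_pos: "Im (vec2_to_complex v) > 0" if "v \<in> S" for v
    using that X by (auto simp: S_def uhp_def)
  have gS: "g ` S = vec2_to_complex -` (moebius A ` X)"
  proof (intro equalityI subsetI)
    fix v assume "v \<in> g ` S"
    then show "v \<in> vec2_to_complex -` (moebius A ` X)" by (auto simp: g_def S_def)
  next
    fix v assume "v \<in> vec2_to_complex -` (moebius A ` X)"
    then obtain z where z: "z \<in> X" "vec2_to_complex v = moebius A z" by auto
    have "complex_to_vec2 z \<in> S" using z(1) by (simp add: S_def)
    moreover have "v = g (complex_to_vec2 z)" by (simp only: g_def vec2_complex_inverse z(2)[symmetric])
    ultimately show "v \<in> g ` S" by blast
  qed
  have gS_borel: "g ` S \<in> sets borel"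
    unfolding gS using borel_moebius_image[OF A X(2,1)] by (rule vimage_borel)
  have der: "(g has_derivative (\<lambda>h. complex_to_vec2 (u v * vec2_to_complex h))) (at v within S)" if "v \<in> S" for v
  proof -
    have "(moebius A has_derivative (*) (u v)) (at (vec2_to_complex v))"
      using has_derivative_moebius[OF A Im_pos[OF that]] by (simp add: has_field_derivative_def u_def)
    then have "((\<lambda>v. moebius A (vec2_to_complex v)) has_derivative (\<lambda>h. u v * vec2_to_complex h)) (at v within S)"
      by (rule has_derivative_compose[OF bounded_linear.has_derivative[OF bounded_linear_vec2_to_complex has_derivative_ident]])
    then show ?thesis
      unfolding g_def by (rule bounded_linear.has_derivative[OF bounded_linear_complex_to_vec2])
  qed
  have inj: "inj_on g S"
  proof (rule inj_onI)
    fix v w assume vw: "v \<in> S" "w \<in> S" "g v = g w"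
    then have "vec2_to_complex (g v) = vec2_to_complex (g w)" by simp
    then have "moebius A (vec2_to_complex v) = moebius A (vec2_to_complex w)" by (simp only: g_def vec2_complex_inverse)
    then have "vec2_to_complex v = vec2_to_complex w"
      using inj_on_moebius[OF A] vw X by (auto simp: S_def inj_on_def)
    then have "complex_to_vec2 (vec2_to_complex v) = complex_to_vec2 (vec2_to_complex w)" by (rule arg_cong)
    then show "v = w" by (simp only: vec2_complex_inverse)
  qed
  have jac: "\<bar>det (matrix (\<lambda>h. complex_to_vec2 (u v * vec2_to_complex h)))\<bar> *\<^sub>R f (g v) = f v" if "v \<in> S" for v
    unfolding det_complex_mult using Im_pos[OF that] denom_nonzero[OF A Im_pos[OF that]]
    by (simp add: f_def g_def u_def Im_moebius[OF A] vec_eq_iff norm_divide norm_power power_divide field_simps)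
  have "((\<lambda>v. indicator S v / (v $ 2)\<^sup>2) has_integral m) UNIV"
    using m S emeasure_hyp_real2[OF X] by (intro nn_integral_has_integral) (auto simp: S_def)
  then have "((\<lambda>v. if v \<in> S then 1 / (v $ 2)\<^sup>2 else 0) has_integral m) UNIV"
    by (rule has_integral_cong[THEN iffD1, rotated]) (simp add: indicator_def)
  then have int: "((\<lambda>v. 1 / (v $ 2)\<^sup>2) has_integral m) S"
    by (simp add: has_integral_restrict_UNIV)
  have "f absolutely_integrable_on S \<and> integral S f = vec m"
    using int unfolding absolutely_integrable_on_1_iff integral_on_1_eq
    by (auto simp: f_def has_integral_iff intro!: nonnegative_absolutely_integrable_1)
  then have "(\<lambda>v. \<bar>det (matrix (\<lambda>h. complex_to_vec2 (u v * vec2_to_complex h)))\<bar> *\<^sub>R f (g v)) absolutely_integrable_on S \<and>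
      integral S (\<lambda>v. \<bar>det (matrix (\<lambda>h. complex_to_vec2 (u v * vec2_to_complex h)))\<bar> *\<^sub>R f (g v)) = vec m"
    using jac by (simp cong: absolutely_integrable_spike_eq integral_cong set_integrable_cong)
  then have "f absolutely_integrable_on g ` S \<and> integral (g ` S) f = vec m"
    using has_absolute_integral_change_of_variables[OF _ der inj, of f "vec m"] S by auto
  then have "((\<lambda>v. 1 / (v $ 2)\<^sup>2) has_integral m) (g ` S)"
    unfolding absolutely_integrable_on_1_iff integral_on_1_eq
    by (auto simp: f_def has_integral_iff absolutely_integrable_on_def)
  then have "((\<lambda>v. if v \<in> g ` S then 1 / (v $ 2)\<^sup>2 else 0) has_integral m) UNIV"
    by (simp add: has_integral_restrict_UNIV)
  then have "((\<lambda>v. indicator (g ` S) v / (v $ 2)\<^sup>2) has_integral m) UNIV"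
    by (rule has_integral_cong[THEN iffD1, rotated]) (simp add: indicator_def)
  then have "(\<integral>\<^sup>+v. ennreal (indicator (g ` S) v / (v $ 2)\<^sup>2) \<partial>lborel) = ennreal m"
    using gS_borel by (intro nn_integral_has_integral_lborel) auto
  moreover have "moebius A ` X \<subseteq> uhp" using moebius_image[OF A X(2)] by blast
  ultimately show ?thesis
    using emeasure_hyp_real2[OF borel_moebius_image[OF A X(2,1)]] m by (simp add: gS)
qed

section \<open>The standard domain\<close>

lemma std_domain_subset_uhp: "std_domain \<subseteq> uhp"
  by (auto simp: std_domain_def)

lemma borel_std_domain [measurable]: "std_domain \<in> sets borel"
  unfolding std_domain_def uhp_def by measurable

text \<open>Vertical slices become half-lines, the shape in which the area is integrated.\<close>

lemma std_domain_Complex_iff: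
  assumes "\<bar>x\<bar> \<le> 1/2"
  shows "Complex x y \<in> std_domain \<longleftrightarrow> sqrt (1 - x\<^sup>2) \<le> y"
proof -
  have "x\<^sup>2 \<le> (1/2)\<^sup>2" using assms by (intro abs_le_square_iff[THEN iffD1]) simp
  then have x: "1 - x\<^sup>2 > 0" by (simp add: power2_eq_square)
  show ?thesis
  proof (cases "y > 0")
    case True
    have "Complex x y \<in> std_domain \<longleftrightarrow> 1 - x\<^sup>2 \<le> y\<^sup>2"
      using True assms by (auto simp: std_domain_def uhp_def cmod_def)
    also have "\<dots> \<longleftrightarrow> sqrt (1 - x\<^sup>2) \<le> y"
      using True real_sqrt_le_iff[of "1 - x\<^sup>2" "y\<^sup>2"] by simp
    finally show ?thesis .
  next
    case False
    have "sqrt (1 - x\<^sup>2) > 0" using x by simp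
    with False have "\<not> sqrt (1 - x\<^sup>2) \<le> y" by linarith
    with False show ?thesis by (simp add: std_domain_def uhp_def)
  qed
qed

text \<open>Integrating 1/y^2 over the slice at x leaves 1 / sqrt(1 - x^2), the derivative of
  arcsin; the endpoints 1/2 and -1/2 contribute pi/6 each.\<close>

lemma emeasure_std_domain: "emeasure hyp_measure std_domain = ennreal (pi / 3)"
proof -
  let ?f = "\<lambda>z. ennreal (indicator uhp z / (Im z)\<^sup>2) * indicator std_domain z"
  have [measurable]: "(\<lambda>(x, y). Complex x y) \<in> borel_measurable (lborel \<Otimes>\<^sub>M lborel)"
    by (simp add: borel_measurable_complex_iff split_beta)
  have [measurable]: "?f \<in> borel_measurable borel" by measurable
  have "emeasure hyp_measure std_domain = (\<integral>\<^sup>+z. ?f z \<partial>lborel)"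
    unfolding hyp_measure_def by (rule emeasure_density) auto
  also have "\<dots> = (\<integral>\<^sup>+p. ?f ((\<lambda>(x, y). Complex x y) p) \<partial>(lborel \<Otimes>\<^sub>M lborel))"
    by (subst lborel_complex_pair) (simp add: nn_integral_distr)
  also have "\<dots> = (\<integral>\<^sup>+x. \<integral>\<^sup>+y. ?f (Complex x y) \<partial>lborel \<partial>lborel)"
    by (subst lborel.nn_integral_fst[symmetric]) auto
  also have "\<dots> = (\<integral>\<^sup>+x. ennreal (1 / sqrt (1 - x\<^sup>2)) * indicator {-1/2..1/2} x \<partial>lborel)"
  proof (rule nn_integral_cong)
    fix x :: real
    show "(\<integral>\<^sup>+y. ?f (Complex x y) \<partial>lborel) = ennreal (1 / sqrt (1 - x\<^sup>2)) * indicator {-1/2..1/2} x"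
    proof (cases "\<bar>x\<bar> \<le> 1/2")
      case True
      then have "x\<^sup>2 \<le> (1/2)\<^sup>2" by (intro abs_le_square_iff[THEN iffD1]) simp
      then have m: "sqrt (1 - x\<^sup>2) > 0" by (simp add: power2_eq_square)
      have "(\<integral>\<^sup>+y. ?f (Complex x y) \<partial>lborel)
          = (\<integral>\<^sup>+y. ennreal (y powr (- 1 - 1)) * indicator {sqrt (1 - x\<^sup>2)..} y \<partial>lborel)"
      proof (rule nn_integral_cong)
        fix y
        show "?f (Complex x y) = ennreal (y powr (- 1 - 1)) * indicator {sqrt (1 - x\<^sup>2)..} y"
        proof (cases "sqrt (1 - x\<^sup>2) \<le> y")
          case le: True
          then have "y > 0" using m by linarith
          with le show ?thesis
            by (simp add: std_domain_Complex_iff[OF True] uhp_def powr_minus_divide)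
        qed (simp add: std_domain_Complex_iff[OF True])
      qed
      also have "\<dots> = ennreal (sqrt (1 - x\<^sup>2) powr - 1 / 1)"
        using m by (intro nn_integral_powr_tail) auto
      also have "sqrt (1 - x\<^sup>2) powr - 1 / 1 = 1 / sqrt (1 - x\<^sup>2)"
        using m by (simp add: powr_minus_divide)
      moreover have "x \<in> {-1/2..1/2}" using True by (auto simp: abs_le_iff)
      ultimately show ?thesis by simp
    next
      case False
      then have "Complex x y \<notin> std_domain" for y by (simp add: std_domain_def)
      moreover have "x \<notin> {-1/2..1/2}" using False by (auto simp: abs_le_iff)
      ultimately show ?thesis by simp
    qed
  qed
  also have "\<dots> = ennreal (arcsin (1/2) - arcsin (-1/2))"
  proof (rule nn_integral_FTC_Icc)
    show "DERIV arcsin x :> 1 / sqrt (1 - x\<^sup>2)" if "x \<in> {-1/2..1/2}" for x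
      using that DERIV_arcsin[of x] by (simp add: inverse_eq_divide)
    show "0 \<le> 1 / sqrt (1 - x\<^sup>2)" if "x \<in> {-1/2..1/2}" for x
    proof -
      have "\<bar>x\<bar> \<le> 1" using that by auto
      then show ?thesis by (simp add: abs_square_le_1)
    qed
  qed auto
  also have "arcsin (1/2) - arcsin (-1/2) = pi / 3"
  proof -
    have "arcsin (1/2) = pi / 6"
      using arcsin_sin[of "pi/6"] by (simp add: sin_30)
    then show ?thesis using arcsin_minus[of "1/2"] by simp
  qed
  finally show ?thesis .
qed

lemma emeasure_hyp_finite_std_domain:
  "X \<subseteq> std_domain \<Longrightarrow> emeasure hyp_measure X < \<infinity>"
  using emeasure_mono[of X std_domain hyp_measure] by (simp add: emeasure_std_domain top.not_eq_extremum le_less_trans)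

lemma emeasure_hyp_moebius_std_domain:
  assumes "A \<in> SL2Z" "X \<in> sets borel" "X \<subseteq> std_domain"
  shows "emeasure hyp_measure (moebius A ` X) = emeasure hyp_measure X"
  using assms std_domain_subset_uhp by (intro emeasure_hyp_moebius emeasure_hyp_finite_std_domain) auto

lemma borel_moebius_std_domain:
  "A \<in> SL2Z \<Longrightarrow> moebius A ` std_domain \<in> sets borel"
  by (rule borel_moebius_image[OF _ std_domain_subset_uhp borel_std_domain])

lemma moebius_std_domain_subset_uhp: "A \<in> SL2Z \<Longrightarrow> moebius A ` std_domain \<subseteq> uhp"
  using moebius_in_uhp std_domain_subset_uhp by blast

text \<open>Turns invariance on sets into an equality of measures, from which a substitution rule
  for integrals follows. The restriction to the standard domain keeps all measures finite.\<close>

lemma distr_moebius_std_domain: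
  assumes A: "A \<in> SL2Z"
  shows "distr (density hyp_measure (indicator std_domain)) borel (moebius A)
    = density hyp_measure (indicator (moebius A ` std_domain))"
proof (rule measure_eqI)
  fix X assume "X \<in> sets (distr (density hyp_measure (indicator std_domain)) borel (moebius A))"
  then have X: "X \<in> sets borel" by simp
  have vX: "moebius A -` X \<in> sets borel"
    using measurable_sets[OF borel_measurable_moebius X] by simp
  have m: "moebius A \<in> measurable (density hyp_measure (indicator std_domain)) borel"
    by (simp cong: measurable_cong_sets)
  have "emeasure (distr (density hyp_measure (indicator std_domain)) borel (moebius A)) X
    = emeasure (density hyp_measure (indicator std_domain)) (moebius A -` X)"
    using X m by (subst emeasure_distr) auto
  also have "\<dots> = emeasure hyp_measure (std_domain \<inter> moebius A -` X)"
    using vX by (intro emeasure_restricted) auto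
  also have "\<dots> = emeasure hyp_measure (moebius A ` (std_domain \<inter> moebius A -` X))"
    using vX by (intro emeasure_hyp_moebius_std_domain[symmetric] A) auto
  also have "moebius A ` (std_domain \<inter> moebius A -` X) = moebius A ` std_domain \<inter> X"
    by blast
  also have "emeasure hyp_measure \<dots> = emeasure (density hyp_measure (indicator (moebius A ` std_domain))) X"
    using X borel_moebius_std_domain[OF A] by (intro emeasure_restricted[symmetric]) auto
  finally show "emeasure (distr (density hyp_measure (indicator std_domain)) borel (moebius A)) X
    = emeasure (density hyp_measure (indicator (moebius A ` std_domain))) X" .
qed simp

lemma set_integral_moebius_std_domain:
  fixes f :: "complex \<Rightarrow> complex"
  assumes A: "A \<in> SL2Z" and f: "continuous_on uhp f" and inv: "\<And>z. z \<in> uhp \<Longrightarrow> f (moebius A z) = f z"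
  shows "set_lebesgue_integral hyp_measure (moebius A ` std_domain) f
    = set_lebesgue_integral hyp_measure std_domain f"
proof -
  \<comment> \<open>Cutting \<open>f\<close> off outside the half-plane makes it Borel on the whole
    plane, as the rules for densities and pushforwards require.\<close>
  define F where "F = (\<lambda>z. indicat_real uhp z *\<^sub>R f z)"
  have F: "F \<in> borel_measurable borel"
    unfolding F_def by (rule borel_measurable_continuous_on_indicator[OF borel_uhp f])
  have dens: "set_lebesgue_integral hyp_measure S f = integral\<^sup>L (density hyp_measure (indicator S)) F"
    if S: "S \<in> sets borel" "S \<subseteq> uhp" for S
  proof -
    have "integral\<^sup>L (density hyp_measure (\<lambda>z. ennreal (indicat_real S z))) F
        = (\<integral>z. indicat_real S z *\<^sub>R F z \<partial>hyp_measure)"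
      using F S by (intro integral_density) (auto cong: measurable_cong_sets)
    also have "\<dots> = set_lebesgue_integral hyp_measure S f"
      unfolding set_lebesgue_integral_def F_def using S
      by (intro Bochner_Integration.integral_cong) (auto simp: indicator_def)
    finally show ?thesis by (simp add: ennreal_indicator)
  qed
  have "set_lebesgue_integral hyp_measure (moebius A ` std_domain) f
      = integral\<^sup>L (distr (density hyp_measure (indicator std_domain)) borel (moebius A)) F"
    using A borel_moebius_std_domain moebius_std_domain_subset_uhp
    by (simp add: dens distr_moebius_std_domain)
  also have "\<dots> = (\<integral>z. F (moebius A z) \<partial>density hyp_measure (indicator std_domain))"
    using F by (intro integral_distr) (auto cong: measurable_cong_sets)
  also have "\<dots> = (\<integral>z. F z \<partial>density hyp_measure (indicator std_domain))"
  proof (rule integral_cong_AE)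
    show "AE z in density hyp_measure (indicator std_domain). F (moebius A z) = F z"
      using std_domain_subset_uhp inv moebius_in_uhp[OF A]
      by (subst AE_density) (auto simp: F_def indicator_def)
  qed (use F in \<open>auto cong: measurable_cong_sets\<close>)
  also have "\<dots> = set_lebesgue_integral hyp_measure std_domain f"
    by (rule dens[symmetric]) (use std_domain_subset_uhp in auto)
  finally show ?thesis .
qed

section \<open>Short vectors and overlaps of the standard domain\<close>

lemma norm_lat_std_domain:
  assumes w: "w \<in> std_domain"
  shows "(of_int (p\<^sup>2 + q\<^sup>2 - \<bar>p * q\<bar>) :: real) \<le> (norm (lat w (p, q)))\<^sup>2"
proof -
  have "1 \<le> (norm w)\<^sup>2" and x: "\<bar>Re w\<bar> \<le> 1/2" using w by (auto simp: std_domain_def)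
  then have n: "1 \<le> (Re w)\<^sup>2 + (Im w)\<^sup>2" by (simp add: cmod_power2)
  \<comment> \<open>In p^2 |w|^2 + 2 p q Re w + q^2 the first term is at least p^2 and the middle
    one at least -|p q| on the domain.\<close>
  have "\<bar>2 * of_int p * of_int q * Re w\<bar> \<le> \<bar>of_int (p * q)\<bar>"
    using mult_left_mono[OF x, of "2 * \<bar>of_int (p * q)\<bar>"] by (simp add: abs_mult mult_ac)
  moreover have "(of_int p)\<^sup>2 * 1 \<le> (of_int p)\<^sup>2 * ((Re w)\<^sup>2 + (Im w)\<^sup>2)"
    using n by (intro mult_left_mono) auto
  moreover have "(norm (lat w (p, q)))\<^sup>2 =
      (of_int p)\<^sup>2 * ((Re w)\<^sup>2 + (Im w)\<^sup>2) + 2 * of_int p * of_int q * Re w + (of_int q)\<^sup>2"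
    by (simp only: cmod_power2) (simp add: power2_eq_square algebra_simps)
  ultimately show ?thesis by (simp add: abs_le_iff)
qed

text \<open>Since 2 |p q| \<le> p^2 + q^2, the integer p^2 + q^2 - |p q| is at least half of p^2 +
  q^2; being positive, it is at least 1.\<close>

lemma norm_lat_std_domain_ge:
  assumes w: "w \<in> std_domain" and pq: "(p, q) \<noteq> (0, 0)"
  shows "1 \<le> norm (lat w (p, q))" "of_int (p\<^sup>2 + q\<^sup>2) / 2 \<le> (norm (lat w (p, q)))\<^sup>2"
proof -
  have "0 \<le> (\<bar>p\<bar> - \<bar>q\<bar>)\<^sup>2" by simp
  then have h: "2 * \<bar>p * q\<bar> \<le> p\<^sup>2 + q\<^sup>2" by (simp add: power2_diff abs_mult mult.assoc)
  then have "(of_int (2 * \<bar>p * q\<bar>) :: real) \<le> of_int (p\<^sup>2 + q\<^sup>2)" by (simp only: of_int_le_iff)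
  then have "(of_int (p\<^sup>2 + q\<^sup>2) :: real) / 2 \<le> of_int (p\<^sup>2 + q\<^sup>2 - \<bar>p * q\<bar>)" by simp
  also note norm_lat_std_domain[OF w]
  finally show "of_int (p\<^sup>2 + q\<^sup>2) / 2 \<le> (norm (lat w (p, q)))\<^sup>2" .
  have "p\<^sup>2 + q\<^sup>2 > 0" using pq by (simp add: sum_power2_gt_zero_iff)
  with h have "p\<^sup>2 + q\<^sup>2 - \<bar>p * q\<bar> \<ge> 1" by linarith
  then have "(1::real) \<le> of_int (p\<^sup>2 + q\<^sup>2 - \<bar>p * q\<bar>)" by (simp only: of_int_1_le_iff)
  also note norm_lat_std_domain[OF w]
  finally have "1\<^sup>2 \<le> (norm (lat w (p, q)))\<^sup>2" by simp
  then show "1 \<le> norm (lat w (p, q))" by (rule power2_le_imp_le) simp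
qed

lemma null_sets_hyp_measure:
  assumes "N \<in> null_sets lborel"
  shows "N \<in> null_sets hyp_measure"
  unfolding hyp_measure_def using assms absolutely_continuousI_density[of "\<lambda>z. ennreal (indicator uhp z / (Im z)\<^sup>2)" lborel]
  by (auto simp: absolutely_continuous_def)

text \<open>Only the diagonal matrices, the identity and its negative, are excluded. If c is
  nonzero, the absence of vectors shorter than 1 at \<open>w\<close> and at its image forces |c w +
  d| = 1, a circle. If c = 0, \<open>h\<close> is a shift by a nonzero integer and \<open>w\<close>
  lies on a vertical boundary line.\<close>

lemma overlap_null:
  assumes h: "h \<in> SL2Z" and ne: "\<not> (h$2$1 = 0 \<and> h$1$2 = 0)"
  shows "{w \<in> std_domain. moebius h w \<in> std_domain} \<in> null_sets hyp_measure"
proof -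
  define a b c d where "a = h$1$1" and "b = h$1$2" and "c = h$2$1" and "d = h$2$2"
  have det: "a * d - b * c = 1" using h by (simp add: SL2Z_iff a_def b_def c_def d_def)
  let ?N = "{w \<in> std_domain. moebius h w \<in> std_domain}"
  have borel: "?N \<in> sets borel"
  proof -
    have "moebius h -` std_domain \<in> sets borel"
      using measurable_sets[OF borel_measurable_moebius borel_std_domain] by simp
    then have "std_domain \<inter> moebius h -` std_domain \<in> sets borel" by simp
    moreover have "?N = std_domain \<inter> moebius h -` std_domain" by blast
    ultimately show ?thesis by (simp only:)
  qed
  have "negligible ?N"
  proof (cases "c = 0")
    case False
    have "?N \<subseteq> sphere (- of_int d / of_int c) (1 / \<bar>of_int c\<bar>)"
    proof
      fix w assume "w \<in> ?N"
      then have w: "w \<in> std_domain" "moebius h w \<in> std_domain" by auto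
      then have im: "Im w > 0" by (simp add: std_domain_def uhp_def)
      have "1 \<le> norm (lat w (c, d))"
        using False by (intro norm_lat_std_domain_ge w) auto
      moreover have "1 \<le> norm (lat (moebius h w) (- c, a))"
        using False by (intro norm_lat_std_domain_ge w) auto
      \<comment> \<open>The automorphy factor of the inverse matrix, whose bottom row is (-c,
        a).\<close>
      moreover have "lat (moebius h w) (- c, a) = 1 / lat w (c, d)"
        using lat_moebius[OF h im, of "- c" a] det
        by (simp add: a_def[symmetric] b_def[symmetric] c_def[symmetric] d_def[symmetric] lat_def algebra_simps flip: of_int_mult of_int_diff)
      ultimately have "norm (lat w (c, d)) = 1"
        by (auto simp: norm_divide divide_simps split: if_splits)
      moreover have "w - (- of_int d / of_int c) = lat w (c, d) / of_int c"
        using False by (simp add: lat_def field_simps)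
      ultimately have "norm (w - (- of_int d / of_int c)) = 1 / \<bar>of_int c\<bar>"
        by (simp only: norm_divide) simp
      then show "w \<in> sphere (- of_int d / of_int c) (1 / \<bar>of_int c\<bar>)"
        by (simp add: dist_norm norm_minus_commute)
    qed
    then show ?thesis using negligible_sphere negligible_subset by blast
  next
    case True
    then have ad: "a * d = 1" using det by simp
    have b: "b \<noteq> 0" using ne True by (auto simp: b_def c_def)
    have "?N \<subseteq> {w. w \<bullet> 1 = 1/2} \<union> {w. w \<bullet> 1 = - 1/2}"
    proof
      fix w assume "w \<in> ?N"
      then have w: "\<bar>Re w\<bar> \<le> 1/2" "\<bar>Re (moebius h w)\<bar> \<le> 1/2" by (auto simp: std_domain_def)
      have "a = 1 \<and> d = 1 \<or> a = - 1 \<and> d = - 1" using ad by (metis zmult_eq_1_iff)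
      then have "moebius h w = w + of_int b \<or> moebius h w = w - of_int b"
        using True by (auto simp: moebius_def a_def b_def c_def d_def)
      then have "Re (moebius h w) = Re w + of_int b \<or> Re (moebius h w) = Re w - of_int b" by auto
      moreover have "1 \<le> \<bar>real_of_int b\<bar>" using b by linarith
      ultimately have "Re w = 1/2 \<or> Re w = - 1/2" using w by linarith
      then show "w \<in> {w. w \<bullet> 1 = 1/2} \<union> {w. w \<bullet> 1 = - 1/2}" by (simp add: inner_complex_def)
    qed
    moreover have "negligible ({w::complex. w \<bullet> 1 = 1/2} \<union> {w. w \<bullet> 1 = - 1/2})"
      by (intro negligible_Un negligible_standard_hyperplane) (auto simp: Basis_complex_def)
    ultimately show ?thesis by (rule negligible_subset[rotated])
  qed
  then have "?N \<in> null_sets lborel"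
    using borel by (simp add: negligible_iff_null_sets null_sets_completion_iff)
  then show ?thesis by (rule null_sets_hyp_measure)
qed

section \<open>Inner products with the test functions\<close>

text \<open>There are M + 1 translates of area pi/3. Translates by g and g' meet in an image of the
  overlap set of h, the inverse of g times g'; a diagonal h would put g' into the coset of
  g.\<close>

lemma Y0_domain_finite_measure:
  assumes M: "prime M"
  shows "Y0_domain M \<in> fmeasurable hyp_measure" "measure hyp_measure (Y0_domain M) = (real M + 1) * (pi / 3)"
proof -
  let ?r = "\<lambda>c. SOME g. g \<in> c"
  have fin: "finite (Gamma0_cosets M)" and card: "card (Gamma0_cosets M) = M + 1"
    using index_nu_prime[OF M] by (simp_all add: index_nu_def)
  have em: "emeasure hyp_measure (moebius (?r c) ` std_domain) = ennreal (pi / 3)" if "c \<in> Gamma0_cosets M" for c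
    using emeasure_hyp_moebius_std_domain[OF coset_rep(2)[OF that]] by (simp add: emeasure_std_domain)
  have fm: "moebius (?r c) ` std_domain \<in> fmeasurable hyp_measure" if "c \<in> Gamma0_cosets M" for c
    using borel_moebius_std_domain[OF coset_rep(2)[OF that]] em[OF that] by (intro fmeasurableI) auto
  show "Y0_domain M \<in> fmeasurable hyp_measure"
    unfolding Y0_domain_def using fin fm by (intro fmeasurable.finite_UN)
  have disj: "AE z in hyp_measure. z \<notin> moebius (?r c) ` std_domain \<or> z \<notin> moebius (?r c') ` std_domain"
    if c: "c \<in> Gamma0_cosets M" "c' \<in> Gamma0_cosets M" "c \<noteq> c'" for c c'
  proof -
    define g g' where "g = ?r c" and "g' = ?r c'"
    have g: "g \<in> SL2Z" "g' \<in> SL2Z" "Gamma0_coset M g = c" "Gamma0_coset M g' = c'"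
      using coset_rep c by (auto simp: g_def g'_def)
    define h where "h = adj22 g ** g'"
    have h: "h \<in> SL2Z" using g by (simp add: h_def SL2Z_mult adj22_SL2Z)
    have ne: "\<not> (h$2$1 = 0 \<and> h$1$2 = 0)"
    proof
      assume 0: "h$2$1 = 0 \<and> h$1$2 = 0"
      have "g' = g ** h" using g by (simp add: h_def matrix_mul_assoc adj22_mult)
      then have "g' $ 2 $ 1 = g$2$1 * h$1$1" "g' $ 2 $ 2 = g$2$2 * h$2$2" "h$1$1 * h$2$2 = 1"
        using 0 h by (simp_all add: mult_nth22 SL2Z_iff)
      moreover from this(3) have "h$1$1 = h$2$2" by (metis zmult_eq_1_iff)
      ultimately have "g' \<in> Gamma0_coset M g"
        unfolding in_Gamma0_coset_iff[OF g(1)] using g(2) by (simp add: mult_ac)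
      then show False using Gamma0_coset_eq[OF g(1)] g c by simp
    qed
    let ?N = "{w \<in> std_domain. moebius h w \<in> std_domain}"
    have N: "?N \<in> null_sets hyp_measure" by (rule overlap_null[OF h ne])
    have "moebius g' ` ?N \<in> null_sets hyp_measure"
    proof (rule null_setsI)
      have "?N \<in> sets borel" using null_setsD2[OF N] by simp
      then show "moebius g' ` ?N \<in> sets hyp_measure"
        using borel_moebius_image[OF g(2), of ?N] std_domain_subset_uhp by auto
      show "emeasure hyp_measure (moebius g' ` ?N) = 0"
        using emeasure_hyp_moebius_std_domain[OF g(2) \<open>?N \<in> sets borel\<close>] null_setsD1[OF N] by auto
    qed
    moreover have "{z \<in> space hyp_measure. \<not> (z \<notin> moebius g ` std_domain \<or> z \<notin> moebius g' ` std_domain)} \<subseteq> moebius g' ` ?N"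
    proof
      fix z assume "z \<in> {z \<in> space hyp_measure. \<not> (z \<notin> moebius g ` std_domain \<or> z \<notin> moebius g' ` std_domain)}"
      then obtain u v where uv: "u \<in> std_domain" "v \<in> std_domain" "z = moebius g u" "z = moebius g' v" by blast
      then have im: "Im u > 0" "Im v > 0" by (auto simp: std_domain_def uhp_def)
      have "moebius h v = moebius (adj22 g) (moebius g u)"
        using uv im g by (simp add: h_def moebius_mult)
      also have "\<dots> = u" using g im by (simp add: moebius_adj)
      finally have "v \<in> ?N" using uv by simp
      then show "z \<in> moebius g' ` ?N" unfolding uv(4) by (rule imageI)
    qed
    ultimately show ?thesis unfolding g_def[symmetric] g'_def[symmetric] by (rule AE_I')
  qed
  have "measure hyp_measure (Y0_domain M) = (\<Sum>c\<in>Gamma0_cosets M. measure hyp_measure (moebius (?r c) ` std_domain))"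
    unfolding Y0_domain_def using fin fm disj by (intro measure_UNION_AE) (auto simp: pairwise_def)
  also have "\<dots> = (\<Sum>c\<in>Gamma0_cosets M. pi / 3)"
    using em by (intro sum.cong refl) (simp add: measure_def)
  finally show "measure hyp_measure (Y0_domain M) = (real M + 1) * (pi / 3)"
    by (simp add: card)
qed

lemma Y0_inner_1_1:
  assumes "prime M"
  shows "Y0_inner M (\<lambda>_. 1) (\<lambda>_. 1) = of_real ((real M + 1) * (pi / 3))"
proof -
  have "Y0_inner M (\<lambda>_. 1) (\<lambda>_. 1) = of_real (measure hyp_measure (Y0_domain M))"
    using Y0_domain_finite_measure(1)[OF assms]
    by (simp add: Y0_inner_def set_lebesgue_integral_def fmeasurable_def scaleR_conv_of_real)
  then show ?thesis by (simp only: Y0_domain_finite_measure(2)[OF assms])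
qed

text \<open>The representative that \<open>Y0_domain\<close> picks in the coset of
  \<open>\<gamma> j\<close>; the two differ by a left factor in \<open>Gamma0 M\<close>.\<close>

definition level_rep :: "nat \<Rightarrow> (nat \<Rightarrow> int^2^2) \<Rightarrow> nat \<Rightarrow> int^2^2" where
  "level_rep M \<gamma> j = (SOME g. g \<in> Gamma0_coset M (\<gamma> j))"

lemma level_rep:
  assumes "coset_reps M \<gamma>" "j \<in> {1..index_nu M}"
  shows "level_rep M \<gamma> j \<in> SL2Z" "level_rep M \<gamma> j \<in> Gamma0_coset M (\<gamma> j)"
    "Gamma0_coset M (level_rep M \<gamma> j) = Gamma0_coset M (\<gamma> j)"
proof -
  have "Gamma0_coset M (\<gamma> j) \<in> Gamma0_cosets M"
    using assms by (auto simp: coset_reps_def Gamma0_cosets_def)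
  from coset_rep[OF this] show "level_rep M \<gamma> j \<in> SL2Z" "level_rep M \<gamma> j \<in> Gamma0_coset M (\<gamma> j)"
    "Gamma0_coset M (level_rep M \<gamma> j) = Gamma0_coset M (\<gamma> j)"
    by (simp_all only: level_rep_def)
qed

lemma coset_reps_level_rep:
  assumes "coset_reps M \<gamma>"
  shows "coset_reps M (level_rep M \<gamma>)"
proof -
  have "disjoint_family_on (\<lambda>j. Gamma0_coset M (level_rep M \<gamma> j)) {1..index_nu M}"
    using assms unfolding coset_reps_def disjoint_family_on_def by (simp add: level_rep(3)[OF assms])
  moreover have "(\<Union>j\<in>{1..index_nu M}. Gamma0_coset M (level_rep M \<gamma> j)) = SL2Z"
    using assms unfolding coset_reps_def by (simp add: level_rep(3)[OF assms])
  ultimately show ?thesis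
    using level_rep(1)[OF assms] by (simp add: coset_reps_def)
qed

text \<open>The integrands agree pointwise, so \<open>F\<close> can be arbitrary. Splitting on
  membership in the j-th translate also settles boundary points shared with other translates: the
  value of \<open>f\<close> is used there.\<close>

lemma Y0_inner_test_function:
  assumes f: "base_function f" and \<gamma>: "coset_reps M \<gamma>" and \<phi>: "test_functions f M \<gamma> \<phi>"
    and j: "j \<in> {1..index_nu M}"
  shows "Y0_inner M F (\<phi> j) =
    set_lebesgue_integral hyp_measure (moebius (level_rep M \<gamma> j) ` std_domain) (\<lambda>z. F z * cnj (f z))"
proof -
  have inv: "f (moebius g z) = f z" if "g \<in> SL2Z" "z \<in> std_domain" for g z
    using f that std_domain_subset_uhp by (auto simp: base_function_def)
  have \<phi>_val: "\<phi> j (moebius g w) = (if k = j then f (moebius g w) else 0)"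
    if k: "k \<in> {1..index_nu M}" and g: "g \<in> Gamma0_coset M (\<gamma> k)" and w: "w \<in> std_domain" for k g w
  proof -
    obtain t where t: "t \<in> Gamma0 M" "g = t ** \<gamma> k" using g by (auto simp: Gamma0_coset_def)
    have "\<gamma> k \<in> SL2Z" using \<gamma> k by (simp add: coset_reps_def)
    then have "g \<in> SL2Z" using g by (simp add: in_Gamma0_coset_iff)
    then have "f (moebius g w) = f w" by (rule inv[OF _ w])
    moreover have "\<phi> j (moebius (t ** \<gamma> k) w) = (if k = j then f w else 0)"
      using \<phi> j k t(1) w unfolding test_functions_def by blast
    ultimately show ?thesis by (cases "k = j") (simp_all add: t(2))
  qed
  let ?g = "level_rep M \<gamma> j"
  have coset: "\<exists>k\<in>{1..index_nu M}. (SOME g. g \<in> c) \<in> Gamma0_coset M (\<gamma> k)" if "c \<in> Gamma0_cosets M" for c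
    using coset_rep(2)[OF that] \<gamma> unfolding coset_reps_def by blast
  have sub: "moebius ?g ` std_domain \<subseteq> Y0_domain M"
  proof -
    have "Gamma0_coset M (\<gamma> j) \<in> Gamma0_cosets M" using \<gamma> j by (auto simp: coset_reps_def Gamma0_cosets_def)
    then show ?thesis unfolding Y0_domain_def level_rep_def by blast
  qed
  have "indicator (Y0_domain M) z *\<^sub>R (F z * cnj (\<phi> j z))
      = indicator (moebius ?g ` std_domain) z *\<^sub>R (F z * cnj (f z))" for z
  proof (cases "z \<in> moebius ?g ` std_domain")
    case True
    then obtain w where "z = moebius ?g w" "w \<in> std_domain" by blast
    then have "\<phi> j z = f z" using \<phi>_val[OF j level_rep(2)[OF \<gamma> j]] by simp
    then show ?thesis using True sub by (auto simp: indicator_def)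
  next
    case False
    have "\<phi> j z = 0" if zY: "z \<in> Y0_domain M"
    proof -
      obtain c w where c: "c \<in> Gamma0_cosets M" "w \<in> std_domain" "z = moebius (SOME g. g \<in> c) w"
        using zY unfolding Y0_domain_def by blast
      obtain k where k: "k \<in> {1..index_nu M}" "(SOME g. g \<in> c) \<in> Gamma0_coset M (\<gamma> k)"
        using coset[OF c(1)] by blast
      have "k \<noteq> j"
      proof
        assume "k = j"
        have "\<gamma> j \<in> SL2Z" using \<gamma> j by (simp add: coset_reps_def)
        then have "c = Gamma0_coset M (\<gamma> j)"
          using coset_rep(3)[OF c(1)] Gamma0_coset_eq k(2) \<open>k = j\<close> by metis
        then show False using c False by (auto simp: level_rep_def)
      qed
      then show ?thesis using \<phi>_val[OF k c(2)] c(3) by simp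
    qed
    then show ?thesis using False by (auto simp: indicator_def)
  qed
  then show ?thesis unfolding Y0_inner_def set_lebesgue_integral_def by simp
qed

lemma base_function_continuous: "base_function f \<Longrightarrow> continuous_on uhp f"
  unfolding base_function_def smooth_on_def by (metis Ck_on.simps(1))

lemma base_function_inv: "base_function f \<Longrightarrow> g \<in> SL2Z \<Longrightarrow> z \<in> uhp \<Longrightarrow> f (moebius g z) = f z"
  unfolding base_function_def by blast

text \<open>Points of the domain where \<open>f\<close> is nonzero lie in the compact set
  \<open>K\<close>. The height bound \<open>Y\<close> later controls the quadratic form from
  below.\<close>

lemma base_function_bounds:
  assumes f: "base_function f"
  obtains B Y where "\<And>z. z \<in> std_domain \<Longrightarrow> norm (f z) \<le> B"
    "\<And>z. z \<in> std_domain \<Longrightarrow> f z \<noteq> 0 \<Longrightarrow> Im z \<le> Y" "Y \<ge> 1" "B \<ge> 0"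
proof -
  define K where "K = closure {z \<in> uhp. f z \<noteq> 0} \<inter> std_domain"
  have K: "compact K" using f by (simp add: base_function_def K_def Let_def)
  have inK: "z \<in> K" if "z \<in> std_domain" "f z \<noteq> 0" for z
    using that std_domain_subset_uhp closure_subset[of "{z \<in> uhp. f z \<noteq> 0}"] unfolding K_def by blast
  obtain Y where Y: "\<And>z. z \<in> K \<Longrightarrow> norm z \<le> Y"
    using compact_imp_bounded[OF K] by (auto simp: bounded_iff)
  have "continuous_on K f"
    using base_function_continuous[OF f]
    by (rule continuous_on_subset) (use std_domain_subset_uhp in \<open>auto simp: K_def\<close>)
  then have "compact (f ` K)" using K by (rule compact_continuous_image)
  then obtain B where B: "\<And>z. z \<in> K \<Longrightarrow> norm (f z) \<le> B"
    using compact_imp_bounded[of "f ` K"] by (auto simp: bounded_iff)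
  show ?thesis
  proof (rule that[of "max B 0" "max Y 1"])
    show "norm (f z) \<le> max B 0" if "z \<in> std_domain" for z
      using inK[OF that] B[of z] by (cases "f z = 0") auto
    show "Im z \<le> max Y 1" if "z \<in> std_domain" "f z \<noteq> 0" for z
      using Y[OF inK[OF that]] abs_Im_le_cmod[of z] by linarith
  qed auto
qed

text \<open>At level 1 there is a single coset, but its chosen representative is an unspecified
  matrix, so integrals over this domain are moved back to the standard one by invariance.\<close>

lemma Y0_domain_1: "Y0_domain 1 = moebius (SOME g. g \<in> SL2Z) ` std_domain" and rep_1: "(SOME g. g \<in> SL2Z) \<in> SL2Z"
proof -
  have 1: "Gamma0_coset 1 g = SL2Z" if "g \<in> SL2Z" for g
    using in_Gamma0_coset_iff[OF that, of _ 1] by auto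
  have I: "mat 1 \<in> SL2Z" by (simp add: mat_1_eq)
  then show "(SOME g. g \<in> SL2Z) \<in> SL2Z" by (rule someI)
  have "Gamma0_cosets 1 = {SL2Z}"
    unfolding Gamma0_cosets_def using 1 I by (auto simp: image_iff)
  then show "Y0_domain 1 = moebius (SOME g. g \<in> SL2Z) ` std_domain"
    by (simp add: Y0_domain_def)
qed

lemma L1_norm_eq:
  assumes f: "base_function f"
  shows "L1_norm f = set_lebesgue_integral hyp_measure std_domain (\<lambda>z. norm (f z))"
proof -
  have "Y0_inner 1 (\<lambda>z. of_real (norm (f z))) (\<lambda>_. 1)
    = set_lebesgue_integral hyp_measure std_domain (\<lambda>z. complex_of_real (norm (f z)))"
    unfolding Y0_inner_def Y0_domain_1 using base_function_continuous[OF f]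
    by (simp, intro set_integral_moebius_std_domain rep_1)
      (auto intro!: continuous_intros simp: base_function_inv[OF f rep_1])
  also have "\<dots> = of_real (set_lebesgue_integral hyp_measure std_domain (\<lambda>z. norm (f z)))"
    by (rule set_integral_complex_of_real)
  finally show ?thesis by (simp add: L1_norm_def)
qed

lemma Y0_inner_1_test_function:
  assumes f: "base_function f" and \<gamma>: "coset_reps M \<gamma>" and \<phi>: "test_functions f M \<gamma> \<phi>"
    and j: "j \<in> {1..index_nu M}"
  shows "Y0_inner M (\<lambda>_. 1) (\<phi> j) = Y0_inner 1 (\<lambda>_. 1) f"
proof -
  have c: "continuous_on uhp (\<lambda>z. cnj (f z))"
    using base_function_continuous[OF f] by (intro continuous_intros)
  have "Y0_inner M (\<lambda>_. 1) (\<phi> j) = set_lebesgue_integral hyp_measure (moebius (level_rep M \<gamma> j) ` std_domain) (\<lambda>z. cnj (f z))"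
    using Y0_inner_test_function[OF assms, of "\<lambda>_. 1"] by simp
  also have "\<dots> = set_lebesgue_integral hyp_measure std_domain (\<lambda>z. cnj (f z))"
    by (intro set_integral_moebius_std_domain level_rep(1)[OF \<gamma> j] c)
      (simp add: base_function_inv[OF f level_rep(1)[OF \<gamma> j]])
  also have "\<dots> = set_lebesgue_integral hyp_measure (moebius (SOME g. g \<in> SL2Z) ` std_domain) (\<lambda>z. cnj (f z))"
    by (intro set_integral_moebius_std_domain[symmetric] rep_1 c) (simp add: base_function_inv[OF f rep_1])
  also have "\<dots> = Y0_inner 1 (\<lambda>_. 1) f" by (simp only: Y0_inner_def Y0_domain_1 mult_1)
  finally show ?thesis .
qed

lemma norm_Y0_inner_test_function_le:
  assumes f: "base_function f" and \<gamma>: "coset_reps M \<gamma>" and \<phi>: "test_functions f M \<gamma> \<phi>"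
    and j: "j \<in> {1..index_nu M}"
    and F: "\<And>w. w \<in> std_domain \<Longrightarrow> f w \<noteq> 0 \<Longrightarrow> norm (F (moebius (level_rep M \<gamma> j) w)) \<le> B" and B: "B \<ge> 0"
  shows "norm (Y0_inner M F (\<phi> j)) \<le> B * L1_norm f"
proof -
  let ?g = "level_rep M \<gamma> j"
  let ?S = "moebius ?g ` std_domain"
  note g = level_rep(1)[OF \<gamma> j]
  have inv: "f (moebius ?g z) = f z" if "z \<in> std_domain" for z
    using base_function_inv[OF f g] that std_domain_subset_uhp by blast
  obtain C where C: "\<And>z. z \<in> std_domain \<Longrightarrow> norm (f z) \<le> C"
    using base_function_bounds[OF f] by metis
  have S: "?S \<in> sets borel" "?S \<subseteq> uhp" "emeasure hyp_measure ?S < \<infinity>"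
    using borel_moebius_std_domain[OF g] moebius_std_domain_subset_uhp[OF g]
      emeasure_hyp_moebius_std_domain[OF g borel_std_domain] by (simp_all add: emeasure_std_domain)
  have int: "set_integrable hyp_measure ?S (\<lambda>z. norm (f z))"
  proof -
    define F' where "F' = (\<lambda>z. indicat_real uhp z *\<^sub>R f z)"
    have [measurable]: "F' \<in> borel_measurable borel" unfolding F'_def
      by (rule borel_measurable_continuous_on_indicator[OF borel_uhp base_function_continuous[OF f]])
    note [measurable] = S(1)
    have "(\<lambda>z. indicat_real ?S z *\<^sub>R norm (F' z)) \<in> borel_measurable hyp_measure"
      by measurable
    also have "(\<lambda>z. indicat_real ?S z *\<^sub>R norm (F' z)) = (\<lambda>z. indicat_real ?S z *\<^sub>R norm (f z))"
      using S(2) by (auto simp: fun_eq_iff indicator_def F'_def)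
    finally have meas: "(\<lambda>z. indicat_real ?S z *\<^sub>R norm (f z)) \<in> borel_measurable hyp_measure" .
    show ?thesis
      unfolding set_integrable_def
    proof (rule integrableI_bounded_set[where A = ?S and B = C])
      show "AE z in hyp_measure. z \<in> ?S \<longrightarrow> norm (indicat_real ?S z *\<^sub>R norm (f z)) \<le> C"
        using C inv by (auto simp: indicator_def)
    qed (use S meas in auto)
  qed
  have "norm (Y0_inner M F (\<phi> j)) \<le> (\<integral>z. norm (indicat_real ?S z *\<^sub>R (F z * cnj (f z))) \<partial>hyp_measure)"
    unfolding Y0_inner_test_function[OF f \<gamma> \<phi> j] set_lebesgue_integral_def by (rule integral_norm_bound)
  also have "\<dots> \<le> (\<integral>z. B * (indicat_real ?S z *\<^sub>R norm (f z)) \<partial>hyp_measure)"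
  \<comment> \<open>This rule asks for integrability of the majorant only; should the left integrand
    fail to be integrable, its integral is 0 by default. The bound thus covers any
    \<open>F\<close>.\<close>
  proof (rule integral_mono')
    show "integrable hyp_measure (\<lambda>z. B * (indicat_real ?S z *\<^sub>R norm (f z)))"
      using int by (simp add: set_integrable_def)
    show "norm (indicat_real ?S z *\<^sub>R (F z * cnj (f z))) \<le> B * (indicat_real ?S z *\<^sub>R norm (f z))" for z
    proof (cases "z \<in> ?S \<and> f z \<noteq> 0")
      case True
      then obtain w where "w \<in> std_domain" "z = moebius ?g w" by blast
      then have "norm (F z) \<le> B" using F True inv by auto
      then show ?thesis using True by (simp add: norm_mult mult_right_mono)
    qed (auto simp: indicator_def)
  qed (use B in simp)
  also have "\<dots> = B * set_lebesgue_integral hyp_measure ?S (\<lambda>z. norm (f z))"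
    by (simp add: set_lebesgue_integral_def)
  also have "set_lebesgue_integral hyp_measure ?S (\<lambda>z. norm (f z)) = L1_norm f"
  proof -
    have "set_lebesgue_integral hyp_measure ?S (\<lambda>z. complex_of_real (norm (f z)))
      = set_lebesgue_integral hyp_measure std_domain (\<lambda>z. complex_of_real (norm (f z)))"
      using base_function_continuous[OF f]
      by (intro set_integral_moebius_std_domain g) (auto intro!: continuous_intros simp: base_function_inv[OF f g])
    then show ?thesis
      unfolding set_integral_complex_of_real L1_norm_eq[OF f] by simp
  qed
  finally show ?thesis .
qed

text \<open>The term n = 1 alone gives L(2, chi) \<ge> 1 for the principal character modulo
  \<open>M\<close>, and zeta(2) = pi^2 / 6 \<le> 2.\<close>

lemma norm_coeff_c1_le:
  assumes M: "prime M"
  shows "norm (coeff_c1 M) \<le> 2 / real M"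
proof -
  have "M > 1" using M prime_gt_1_nat by blast
  let ?t = "\<lambda>d n. principal_character d (int (Suc n)) / of_nat (Suc n) powr (2 :: complex)"
  define a where "a = (\<lambda>d n. (if coprime (int (Suc n)) (int d) then 1 else 0) / (real (Suc n))\<^sup>2)"
  have summand: "?t d n = of_real (a d n)" for d n
  proof -
    have "of_nat (Suc n) powr (2 :: complex) = of_nat (Suc n) ^ 2"
      using powr_nat[of "of_nat (Suc n) :: complex" 2] by (simp del: of_nat_Suc)
    then show ?thesis by (simp add: principal_character_def a_def del: of_nat_Suc)
  qed
  have sq: "summable (\<lambda>n. 1 / (real (Suc n))\<^sup>2)"
    using sums_summable[OF inverse_squares_sums] by (simp add: add.commute)
  have sm: "summable (a d)" for d
    by (rule summable_comparison_test'[OF sq, of 0]) (simp add: a_def)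
  have L: "dirichlet_L (principal_character d) 2 = of_real (\<Sum>n. a d n)" for d
    unfolding dirichlet_L_def summand by (rule suminf_of_real[OF sm, symmetric])
  have "a M 0 = 1" by (simp add: a_def)
  then have ge: "(\<Sum>n. a M n) \<ge> 1"
    using sum_le_suminf[OF sm[of M], of "{0}"] \<open>a M 0 = 1\<close> by (simp add: a_def del: of_nat_Suc)
  have "(\<Sum>n. a 1 n) = pi\<^sup>2 / 6"
    using sums_unique[OF inverse_squares_sums] by (simp add: a_def add.commute)
  also have "\<dots> \<le> 2"
    using pi_less_4 pi_approx mult_mono[of pi "3.15" pi "3.15"] by (simp add: power2_eq_square)
  finally have le: "(\<Sum>n. a 1 n) \<le> 2" .
  have "(\<Sum>n. a 1 n) \<ge> 0" by (rule suminf_nonneg[OF sm]) (simp add: a_def)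
  have "norm (coeff_c1 M) = (\<Sum>n. a 1 n) / (\<Sum>n. a M n) * (1 / real M - 1 / (real M)\<^sup>2)"
  proof -
    have "coeff_c1 M = of_real ((\<Sum>n. a 1 n) / (\<Sum>n. a M n) * (1 / real M - 1 / (real M)\<^sup>2))"
      by (simp add: coeff_c1_def L)
    moreover have "1 / (real M)\<^sup>2 \<le> 1 / real M"
      using \<open>M > 1\<close> by (simp add: power2_eq_square field_simps)
    moreover from this have "(\<Sum>n. a 1 n) / (\<Sum>n. a M n) * (1 / real M - 1 / (real M)\<^sup>2) \<ge> 0"
      using ge \<open>(\<Sum>n. a 1 n) \<ge> 0\<close> by (intro mult_nonneg_nonneg divide_nonneg_nonneg) auto
    ultimately show ?thesis by (simp only: norm_of_real abs_of_nonneg)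
  qed
  also have "\<dots> \<le> 2 * (1 / real M)"
  proof (rule mult_mono)
    show "(\<Sum>n. a 1 n) / (\<Sum>n. a M n) \<le> 2"
      using le ge by (simp add: pos_divide_le_eq)
    show "0 \<le> 1 / real M - 1 / (real M)\<^sup>2"
      using \<open>M > 1\<close> by (simp add: power2_eq_square field_simps)
  qed auto
  finally show ?thesis by simp
qed

section \<open>Level structure and the final estimates\<close>

lemma qform_moebius:
  assumes g: "g \<in> SL2Z" and w: "Im w > 0"
  shows "qform (moebius g w) (p, q) = (norm (lat w (p * g$1$1 + q * g$2$1, p * g$1$2 + q * g$2$2)))\<^sup>2 / Im w"
  using denom_nonzero[OF g w]
  by (simp add: qform_def lat_moebius[OF g w] Im_moebius[OF g] norm_divide power_divide)

lemma SL2Z_row_nonzero: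
  assumes g: "g \<in> SL2Z" and pq: "(p, q) \<noteq> (0, 0)"
  shows "(p * g$1$1 + q * g$2$1, p * g$1$2 + q * g$2$2) \<noteq> (0, 0)"
proof
  assume "(p * g$1$1 + q * g$2$1, p * g$1$2 + q * g$2$2) = (0, 0)"
  then have 0: "p * g$1$1 + q * g$2$1 = 0" "p * g$1$2 + q * g$2$2 = 0" by simp_all
  have det: "g$1$1 * g$2$2 - g$1$2 * g$2$1 = 1" using g by (simp add: SL2Z_iff)
  have "p * (g$1$1 * g$2$2 - g$1$2 * g$2$1) =
      (p * g$1$1 + q * g$2$1) * g$2$2 - (p * g$1$2 + q * g$2$2) * g$2$1"
    "q * (g$1$1 * g$2$2 - g$1$2 * g$2$1) =
      (p * g$1$2 + q * g$2$2) * g$1$1 - (p * g$1$1 + q * g$2$1) * g$1$2"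
    by (simp_all add: algebra_simps)
  then have "p = 0" "q = 0" unfolding 0 det by simp_all
  with pq show False by simp
qed

lemma qform_moebius_ge:
  assumes g: "g \<in> SL2Z" and w: "w \<in> std_domain" "Im w \<le> Y" and pq: "(p, q) \<noteq> (0, 0)"
  shows "of_int ((p * g$1$1 + q * g$2$1)\<^sup>2 + (p * g$1$2 + q * g$2$2)\<^sup>2) / (2 * Y) \<le> qform (moebius g w) (p, q)"
proof -
  have im: "Im w > 0" using w by (simp add: std_domain_def uhp_def)
  let ?n = "of_int ((p * g$1$1 + q * g$2$1)\<^sup>2 + (p * g$1$2 + q * g$2$2)\<^sup>2) :: real"
  have "?n / (2 * Y) = (?n / 2) / Y" by simp
  also have "\<dots> \<le> (norm (lat w (p * g$1$1 + q * g$2$1, p * g$1$2 + q * g$2$2)))\<^sup>2 / Im w"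
    using im w by (intro frac_le norm_lat_std_domain_ge SL2Z_row_nonzero[OF g pq]) auto
  also have "\<dots> = qform (moebius g w) (p, q)" by (rule qform_moebius[OF g im, symmetric])
  finally show ?thesis .
qed

text \<open>A nonzero integer row has squared length at least 1, which already gives 1/(2 Y); the
  weaker constant matches the bound at level \<open>M\<close>.\<close>

lemma qform_moebius_lower:
  assumes g: "g \<in> SL2Z" and w: "w \<in> std_domain" "Im w \<le> Y" and Y: "Y \<ge> 1" and v: "v \<noteq> (0, 0)"
  shows "1 / (32 * Y) \<le> qform (moebius g w) v"
proof -
  obtain p q where pq: "v = (p, q)" by (cases v)
  let ?n = "(p * g$1$1 + q * g$2$1)\<^sup>2 + (p * g$1$2 + q * g$2$2)\<^sup>2"
  have "?n > 0" using SL2Z_row_nonzero[OF g] v unfolding pq by (simp only: sum_power2_gt_zero_iff) blast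
  then have "1 \<le> ?n" by linarith
  then have "(1::real) \<le> of_int ?n" by (simp only: of_int_1_le_iff)
  then have "1 / (32 * Y) \<le> of_int ?n / (2 * Y)" using Y by (intro frac_le) auto
  also have "\<dots> \<le> qform (moebius g w) (p, q)" using v by (intro qform_moebius_ge g w) (simp add: pq)
  finally show ?thesis by (simp only: pq)
qed

lemma qform_scaled: "M > 0 \<Longrightarrow> qform (of_nat M * z) (p, q) = qform z (p * int M, q) / real M"
  by (simp add: qform_def lat_def mult.assoc)

text \<open>The form at M z on (c, d) is 1/M times the form at z on (c M, d). Pulled back by
  \<open>g\<close>, this vector becomes (p, q), congruent modulo \<open>M\<close> to d times the
  bottom row of \<open>g\<close>, so \<open>good\<close> gives p^2 + q^2 \<ge> M/16 and the factor
  \<open>M\<close> cancels.\<close>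

lemma qform_level_lower:
  assumes g: "g \<in> SL2Z" and w: "w \<in> std_domain" "Im w \<le> Y" and Y: "Y \<ge> 1" and M: "M > 0"
    and good: "\<And>p q. (p, q) \<noteq> (0, 0) \<Longrightarrow> int M dvd p * g$2$2 - q * g$2$1 \<Longrightarrow> int M \<le> 16 * (p\<^sup>2 + q\<^sup>2)"
    and v: "v \<noteq> (0, 0)"
  shows "1 / (32 * Y) \<le> qform (of_nat M * moebius g w) v"
proof -
  obtain c d where cd: "v = (c, d)" by (cases v)
  define p q where "p = c * int M * g$1$1 + d * g$2$1" and "q = c * int M * g$1$2 + d * g$2$2"
  have ne: "(c * int M, d) \<noteq> (0, 0)" using v M by (simp add: cd)
  have "p * g$2$2 - q * g$2$1 = int M * (c * (g$1$1 * g$2$2 - g$1$2 * g$2$1))"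
    by (simp add: p_def q_def algebra_simps)
  then have "int M dvd p * g$2$2 - q * g$2$1" by simp
  moreover have "(p, q) \<noteq> (0, 0)" unfolding p_def q_def by (rule SL2Z_row_nonzero[OF g ne])
  ultimately have "int M \<le> 16 * (p\<^sup>2 + q\<^sup>2)" by (intro good)
  then have "real_of_int (int M) \<le> of_int (16 * (p\<^sup>2 + q\<^sup>2))" by (simp only: of_int_le_iff)
  then have "real M / 16 \<le> of_int (p\<^sup>2 + q\<^sup>2)" by simp
  then have "(real M / 16) / (2 * Y) \<le> of_int (p\<^sup>2 + q\<^sup>2) / (2 * Y)"
    using Y by (intro divide_right_mono) auto
  also have "\<dots> \<le> qform (moebius g w) (c * int M, d)"
    unfolding p_def q_def by (rule qform_moebius_ge[OF g w ne])
  finally have "(real M / 16) / (2 * Y) / real M \<le> qform (moebius g w) (c * int M, d) / real M"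
    by (intro divide_right_mono) auto
  then show ?thesis using M by (simp add: cd qform_scaled)
qed

text \<open>The prefactor is a = 3 / (pi (M + 1)). In the error, ln M stems from ln(N^2 / M), and ln
  N / M from replacing M + 1 by M in the main term.\<close>

lemma coeff_c0_estimate:
  fixes chi :: "int \<Rightarrow> complex" and T :: real and r :: complex
  assumes M: "prime M" and N: "N > 0"
  defines "L \<equiv> Re (L_logderiv (\<lambda>n. cnj (chi n)) (Complex 1 (2 * T)))"
  shows "norm (coeff_c0 M N chi T r - of_real (6 * ln (real N) / (pi * real M)))
    \<le> 4 * ((ln (real M) + \<bar>L\<bar> + norm r + ln (real N) / real M) / real M)"
proof -
  have M1: "M > 1" using M prime_gt_1_nat by blast
  define a where "a = 3 / (pi * (real M + 1))"
  have "a \<le> 3 / (3 * real M)"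
    unfolding a_def using M1 pi_gt3 by (intro divide_left_mono mult_mono) auto
  then have a: "0 \<le> a" "a \<le> 1 / real M" by (simp_all add: a_def)
  have ln: "ln (real M) \<ge> 0" "ln (real N) \<ge> 0" "ln (real N ^ 2 / real M) = 2 * ln (real N) - ln (real M)"
    using M1 N by (simp_all add: ln_div ln_realpow)
  \<comment> \<open>Both sides are -6 ln N / (pi M (M + 1)).\<close>
  have eq1: "of_real (a * (2 * ln (real N))) - of_real (6 * ln (real N) / (pi * real M)) = complex_of_real (- (2 * a * ln (real N) / real M))"
  proof -
    have "a * (2 * ln (real N)) - 6 * ln (real N) / (pi * real M) = - (2 * a * ln (real N) / real M)"
      unfolding a_def using M1 by (simp add: divide_simps) (simp add: algebra_simps)
    then show ?thesis by (metis of_real_diff)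
  qed
  have "coeff_c0 M N chi T r = of_real a * (of_real (2 * ln (real N) - ln (real M) + 4 * L) + r)"
    unfolding coeff_c0_def Y0_inner_1_1[OF M] L_def[symmetric] ln(3) a_def by (simp add: mult.commute)
  also have "\<dots> = of_real (a * (2 * ln (real N))) + of_real a * (of_real (- ln (real M) + 4 * L) + r)"
    by (simp add: algebra_simps)
  finally have eq: "coeff_c0 M N chi T r - of_real (6 * ln (real N) / (pi * real M))
      = of_real a * (of_real (- ln (real M) + 4 * L) + r) + of_real (- (2 * a * ln (real N) / real M))"
    unfolding eq1[symmetric] by (simp only: diff_conv_add_uminus ac_simps)
  have "norm (coeff_c0 M N chi T r - of_real (6 * ln (real N) / (pi * real M)))
      \<le> a * (\<bar>- ln (real M) + 4 * L\<bar> + norm r) + 2 * a * ln (real N) / real M"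
  proof -
    have "norm (of_real a * (of_real (- ln (real M) + 4 * L) + r)) \<le> a * (\<bar>- ln (real M) + 4 * L\<bar> + norm r)"
      unfolding norm_mult using a norm_triangle_ineq[of "of_real (- ln (real M) + 4 * L)" r]
      by (simp only: norm_of_real abs_of_nonneg mult_left_mono)
    moreover have "norm (complex_of_real (- (2 * a * ln (real N) / real M))) = 2 * a * ln (real N) / real M"
      unfolding norm_of_real using a ln by simp
    ultimately show ?thesis
      unfolding eq by (intro norm_triangle_le add_mono) auto
  qed
  also have "\<dots> = a * (\<bar>- ln (real M) + 4 * L\<bar> + norm r + 2 * (ln (real N) / real M))"
    by (simp add: algebra_simps)
  also have "\<dots> \<le> (1 / real M) * (4 * (ln (real M) + \<bar>L\<bar> + norm r + ln (real N) / real M))"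
  proof (rule mult_mono)
    have aux: "\<bar>- x + 4 * l\<bar> + n + 2 * q \<le> 4 * (x + \<bar>l\<bar> + n + q)"
      if "0 \<le> x" "0 \<le> n" "0 \<le> q" for x l n q :: real
      using that by (auto simp: abs_if)
    show "\<bar>- ln (real M) + 4 * L\<bar> + norm r + 2 * (ln (real N) / real M)
        \<le> 4 * (ln (real M) + \<bar>L\<bar> + norm r + ln (real N) / real M)"
      using ln by (intro aux) auto
  qed (use a ln in auto)
  finally show ?thesis by simp
qed

lemma L1_norm_nonneg: "base_function f \<Longrightarrow> L1_norm f \<ge> 0"
  unfolding L1_norm_eq set_lebesgue_integral_def by (intro integral_nonneg_AE) auto

theorem theorem1p12:
  "\<exists>\<delta>::real. \<delta> > 0 \<and>
    (\<forall>\<phi>\<^sub>0. base_function \<phi>\<^sub>0 \<longrightarrow>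
      (\<exists>C::real. \<forall>M::nat. prime M \<longrightarrow>
        (\<forall>\<gamma> \<phi>. coset_reps M \<gamma> \<and> test_functions \<phi>\<^sub>0 M \<gamma> \<phi> \<longrightarrow>
          (\<exists>J \<subseteq> {1..index_nu M}. real (card J) \<ge> \<delta> * real M \<and>
            (\<forall>j\<in>J.
              norm (coeff_c1 M) * norm (Y0_inner M eisenstein_G (\<phi> j))
                + norm (coeff_cM M) * norm (Y0_inner M (eisenstein_G_level M) (\<phi> j))
                \<le> C * (1 / real M) * L1_norm \<phi>\<^sub>0 \<and>
              (\<forall>(N::nat) chi (T::real) r.
                primitive_character N chi \<and> even_character chi \<and> M dvd N \<and> T \<noteq> 0 \<longrightarrow>
                norm (coeff_c0 M N chi T r * Y0_inner M (\<lambda>_. 1) (\<phi> j)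
                      - of_real (6 * ln (real N) / (pi * real M)) * Y0_inner 1 (\<lambda>_. 1) \<phi>\<^sub>0)
                \<le> C * ((ln (real M)
                        + \<bar>Re (L_logderiv (\<lambda>n. cnj (chi n)) (Complex 1 (2 * T)))\<bar>
                        + norm r + ln (real N) / real M) / real M)
                    * norm (Y0_inner 1 (\<lambda>_. 1) \<phi>\<^sub>0)))))))"
proof -
  have "\<exists>C::real. \<forall>M::nat. prime M \<longrightarrow>
        (\<forall>\<gamma> \<phi>. coset_reps M \<gamma> \<and> test_functions f M \<gamma> \<phi> \<longrightarrow>
          (\<exists>J \<subseteq> {1..index_nu M}. real (card J) \<ge> 1/2 * real M \<and>
            (\<forall>j\<in>J.
              norm (coeff_c1 M) * norm (Y0_inner M eisenstein_G (\<phi> j))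
                + norm (coeff_cM M) * norm (Y0_inner M (eisenstein_G_level M) (\<phi> j))
                \<le> C * (1 / real M) * L1_norm f \<and>
              (\<forall>(N::nat) chi (T::real) r.
                primitive_character N chi \<and> even_character chi \<and> M dvd N \<and> T \<noteq> 0 \<longrightarrow>
                norm (coeff_c0 M N chi T r * Y0_inner M (\<lambda>_. 1) (\<phi> j)
                      - of_real (6 * ln (real N) / (pi * real M)) * Y0_inner 1 (\<lambda>_. 1) f)
                \<le> C * ((ln (real M)
                        + \<bar>Re (L_logderiv (\<lambda>n. cnj (chi n)) (Complex 1 (2 * T)))\<bar>
                        + norm r + ln (real N) / real M) / real M)
                    * norm (Y0_inner 1 (\<lambda>_. 1) f)))))"
    (is "\<exists>C. \<forall>M. _ \<longrightarrow> (\<forall>\<gamma> \<phi>. _ \<longrightarrow> (\<exists>J\<subseteq>_. _ \<and> (\<forall>j\<in>J. ?c1 C M \<phi> j \<and> ?c0 C M \<phi> j)))")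
    if f: "base_function f" for f
  proof -
    obtain Y where Y: "\<And>z. z \<in> std_domain \<Longrightarrow> f z \<noteq> 0 \<Longrightarrow> Im z \<le> Y" "Y \<ge> 1"
      using base_function_bounds[OF f] by metis
    define m where "m = 1 / (32 * Y)"
    have m: "0 < m" "m \<le> 1" using Y(2) by (simp_all add: m_def)
    obtain B0 where B0: "\<And>z. Im z > 0 \<Longrightarrow> (\<And>v. v \<noteq> (0, 0) \<Longrightarrow> m \<le> qform z v) \<Longrightarrow> norm (eisenstein_G z) \<le> B0"
      using eisenstein_G_bound[OF m] by metis
    define B where "B = max B0 0"
    have B: "B \<ge> 0" by (simp add: B_def)
    have GB: "norm (eisenstein_G z) \<le> B" if "Im z > 0" "\<And>v. v \<noteq> (0, 0) \<Longrightarrow> m \<le> qform z v" for z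
      using B0[OF that] by (simp add: B_def)
    show ?thesis
    \<comment> \<open>4 B serves the two terms in \<open>G\<close>, each at most (2 / M) B times the
      L1 norm; 4 is the constant of \<open>coeff_c0_estimate\<close>.\<close>
    proof (intro exI[of _ "4 * B + 4"] allI impI, elim conjE)
      fix M :: nat and \<gamma> \<phi>
      assume M: "prime M" and \<gamma>: "coset_reps M \<gamma>" and \<phi>: "test_functions f M \<gamma> \<phi>"
      have M1: "M > 1" using M prime_gt_1_nat by blast
      let ?g = "level_rep M \<gamma>"
      \<comment> \<open>Tested on the representatives built into \<open>Y0_domain\<close>, since the
        integrals unfold over those translates.\<close>
      define bad where "bad = {j \<in> {1..index_nu M}. \<exists>p q. (p, q) \<noteq> (0, 0) \<and> 16 * (p\<^sup>2 + q\<^sup>2) < int M \<and>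
                     int M dvd p * ?g j$2$2 - q * ?g j$2$1}"
      define J where "J = {1..index_nu M} - bad"
      have "2 * card bad \<le> M"
        unfolding bad_def by (rule card_bad_cosets[OF M coset_reps_level_rep[OF \<gamma>]])
      moreover have "card J = index_nu M - card bad"
        unfolding J_def by (subst card_Diff_subset) (auto simp: bad_def)
      \<comment> \<open>Of M + 1 cosets at most M/2 are lost, whence \<open>\<delta>\<close> =
        1/2.\<close>
      ultimately have card: "real (card J) \<ge> 1/2 * real M"
        using index_nu_prime(2)[OF M] by linarith
      have G_bounds: "norm (Y0_inner M eisenstein_G (\<phi> j)) \<le> B * L1_norm f"
        "norm (Y0_inner M (eisenstein_G_level M) (\<phi> j)) \<le> B * L1_norm f" if j: "j \<in> J" for j
      proof -
        have j': "j \<in> {1..index_nu M}" using j by (simp add: J_def)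
        note g = level_rep(1)[OF \<gamma> j']
        have good: "int M \<le> 16 * (p\<^sup>2 + q\<^sup>2)"
          if pq: "(p, q) \<noteq> (0, 0)" "int M dvd p * ?g j$2$2 - q * ?g j$2$1" for p q
        proof (rule ccontr)
          assume "\<not> int M \<le> 16 * (p\<^sup>2 + q\<^sup>2)"
          then have "j \<in> bad" using pq j' unfolding bad_def by (auto simp: not_le)
          with j show False by (simp add: J_def)
        qed
        have im: "Im (moebius (?g j) w) > 0" if "w \<in> std_domain" for w
          using Im_moebius_pos[OF g] that by (simp add: std_domain_def uhp_def)
        show "norm (Y0_inner M eisenstein_G (\<phi> j)) \<le> B * L1_norm f"
        proof (rule norm_Y0_inner_test_function_le[OF f \<gamma> \<phi> j' _ B])
          fix w assume w: "w \<in> std_domain" "f w \<noteq> 0"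
          show "norm (eisenstein_G (moebius (?g j) w)) \<le> B"
            by (intro GB im w) (auto simp: m_def intro!: qform_moebius_lower[OF g w(1) Y(1)[OF w] Y(2)])
        qed
        show "norm (Y0_inner M (eisenstein_G_level M) (\<phi> j)) \<le> B * L1_norm f"
        proof (rule norm_Y0_inner_test_function_le[OF f \<gamma> \<phi> j' _ B])
          fix w assume w: "w \<in> std_domain" "f w \<noteq> 0"
          have "norm (eisenstein_G (of_nat M * moebius (?g j) w)) \<le> B"
          proof (rule GB)
            show "Im (of_nat M * moebius (?g j) w) > 0" using im[OF w(1)] M1 by simp
            show "m \<le> qform (of_nat M * moebius (?g j) w) v" if "v \<noteq> (0, 0)" for v
              unfolding m_def using M1 by (intro qform_level_lower g w Y good that) auto
          qed
          then show "norm (eisenstein_G_level M (moebius (?g j) w)) \<le> B"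
            by (simp add: eisenstein_G_level_def)
        qed
      qed
      show "\<exists>J\<subseteq>{1..index_nu M}. real (card J) \<ge> 1/2 * real M \<and>
          (\<forall>j\<in>J. ?c1 (4 * B + 4) M \<phi> j \<and> ?c0 (4 * B + 4) M \<phi> j)"
      proof (intro exI[of _ J] conjI ballI allI impI card)
        show "J \<subseteq> {1..index_nu M}" by (auto simp: J_def)
      next
        fix j assume j: "j \<in> J"
        have L1: "L1_norm f \<ge> 0" by (rule L1_norm_nonneg[OF f])
        have "norm (coeff_c1 M) * norm (Y0_inner M eisenstein_G (\<phi> j))
                + norm (coeff_cM M) * norm (Y0_inner M (eisenstein_G_level M) (\<phi> j))
            \<le> 2 / real M * (B * L1_norm f) + 2 / real M * (B * L1_norm f)"
          unfolding coeff_cM_def by (intro add_mono mult_mono norm_coeff_c1_le[OF M] G_bounds[OF j]) auto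
        also have "\<dots> = 4 * B * (1 / real M) * L1_norm f" by simp
        also have "\<dots> \<le> (4 * B + 4) * (1 / real M) * L1_norm f"
          using L1 by (intro mult_right_mono) auto
        finally show "?c1 (4 * B + 4) M \<phi> j" .
      next
        fix j and N :: nat and chi :: "int \<Rightarrow> complex" and T :: real and r :: complex
        assume j: "j \<in> J" and chi: "primitive_character N chi \<and> even_character chi \<and> M dvd N \<and> T \<noteq> 0"
        have N: "N > 0" using chi by (simp add: primitive_character_def dirichlet_character_def)
        have j': "j \<in> {1..index_nu M}" using j by (simp add: J_def)
        let ?L = "\<bar>Re (L_logderiv (\<lambda>n. cnj (chi n)) (Complex 1 (2 * T)))\<bar>"
        let ?I = "Y0_inner 1 (\<lambda>_. 1) f"
        let ?R = "(ln (real M) + ?L + norm r + ln (real N) / real M) / real M"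
        have R: "0 \<le> ?R" using M1 N by simp
        have "norm (coeff_c0 M N chi T r * Y0_inner M (\<lambda>_. 1) (\<phi> j) - of_real (6 * ln (real N) / (pi * real M)) * ?I)
            = norm (coeff_c0 M N chi T r - of_real (6 * ln (real N) / (pi * real M))) * norm ?I"
          unfolding Y0_inner_1_test_function[OF f \<gamma> \<phi> j'] by (simp only: left_diff_distrib[symmetric] norm_mult)
        also have "\<dots> \<le> (4 * B + 4) * ?R * norm ?I"
        proof (rule mult_right_mono)
          have "4 * ?R \<le> (4 * B + 4) * ?R" using R B by (intro mult_right_mono) auto
          with coeff_c0_estimate[OF M N, of chi T r]
          show "norm (coeff_c0 M N chi T r - of_real (6 * ln (real N) / (pi * real M))) \<le> (4 * B + 4) * ?R"
            by (rule order_trans)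
        qed simp
        finally show "norm (coeff_c0 M N chi T r * Y0_inner M (\<lambda>_. 1) (\<phi> j) - of_real (6 * ln (real N) / (pi * real M)) * ?I)
            \<le> (4 * B + 4) * ?R * norm ?I" .
      qed
    qed
  qed
  note key = this
  show ?thesis
    by (rule exI[of _ "1/2"], rule conjI, simp, intro allI impI, rule key)
qed

end
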